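(* Let $m>0$, $|a|<m$, let $\varepsilon\in\{-1,+1\}$, $S<0$, $R,\widetilde R\in\mathbb R$, and use Kerr coordinates $(w,r,\theta,\varphi)$, outgoing if $\varepsilon=-1$ and ingoing if $\varepsilon=+1$. Let $\mathfrak W$ be the generalized Whiting transform with parameters $S,R,\widetilde R$. There exists a metric $\widetilde{\mathbf g}$ (possibly degenerate or of changing signature), of the same split form as the Kerr metric, whose rescaled inverse metric in coordinates $(\widetilde w,\widetilde r,\widetilde\theta,\widetilde\varphi)$ is $$|\widetilde q|^2\,\widetilde{\mathbf g}^{\alpha\beta}=\widetilde{\mathbf h}^{\alpha\beta}+O^{\alpha\beta},$$ such that for every smooth $\psi$ with support bounded in $r$, $$\mathfrak W\big[|q|^2\square_{\mathbf g}\psi\big]=|\widetilde q|^2\square_{\widetilde{\mathbf g}}\mathfrak W[\psi]+\mathcal E_+[\psi],$$ where $$|\widetilde q|^2\square_{\widetilde{\mathbf g}}\widetilde\psi:=\partial_\alpha\big(\widetilde{\mathbf h}^{\alpha\beta}\partial_\beta\widetilde\psi\big)+\frac1{\sin\widetilde\theta}\partial_\alpha\big(\sin\widetilde\theta\,O^{\alpha\beta}\partial_\beta\widetilde\psi\big),$$ the horizon boundary term is $$\mathcal E_+[\psi]=-2\mathbf h^{wr}(r_+)(\partial_w\psi)_+-2\mathbf h^{r\varphi}(r_+)(\partial_\varphi\psi)_+,$$ and, with $X=S(\widetilde r-\widetilde R)$, $A_R=R^2+a^2$, $\Delta_R=\Delta(R)$, $\Delta_R'=2(R-m)$, the non-vanishing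 components of $\widetilde{\mathbf h}$ are $$\widetilde{\mathbf h}^{\widetilde r\widetilde r}=S^{-2}X(X-2\varepsilon),\qquad \widetilde{\mathbf h}^{\widetilde w\widetilde r}=\widetilde{\mathbf h}^{\widetilde r\widetilde w}=S^{-1}\big(\tfrac12\Delta_R'X^2-2\varepsilon RX\big),$$ $$\widetilde{\mathbf h}^{\widetilde w\widetilde w}=\Delta_RX^2-2\varepsilon A_RX,\qquad \widetilde{\mathbf h}^{\widetilde w\widetilde\varphi}=\widetilde{\mathbf h}^{\widetilde\varphi\widetilde w}=-\varepsilon aX .$$
   Context: **Kerr in Eddington–Finkelstein coordinates.** $\Delta=r^2-2mr+a^2=(r-r_+)(r-r_-)$, $r_\pm=m\pm\sqrt{m^2-a^2}$, $q=r+ia\cos\theta$. With Boyer–Lindquist $(t,r,\theta,\phi)$, $r_*'=\frac{r^2+a^2}\Delta$, $\phi_*'=\frac a\Delta$: outgoing coordinates ($\varepsilon=-1$) are $w=u=t-r_*$, $\varphi=\phi-\phi_*$; ingoing coordinates ($\varepsilon=+1$) are $w=v=t+r_*$, $\varphi=\phi+\phi_*$. In these coordinates $|q|^2\mathbf g^{\alpha\beta}=\mathbf h^{\alpha\beta}+O^{\alpha\beta}$, with non-vanishing components $$\mathbf h^{rr}=\Delta,\quad \mathbf h^{wr}=\mathbf h^{rw}=\varepsilon(r^2+a^2),\quad \mathbf h^{r\varphi}=\mathbf h^{\varphi r}=\varepsilon a,$$ $$O^{\alpha\beta}=\partial_\theta^\alpha\partial_\theta^\beta+\frac1{\sin^2\theta}\big(a\sin^2\theta\,\partial_w+\partial_\varphi\big)^\alpha\big(a\sin^2\theta\,\partial_w+\partial_\varphi\big)^\beta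 ,$$ and the wave operator is $|q|^2\square_{\mathbf g}\psi=\partial_\alpha(\mathbf h^{\alpha\beta}\partial_\beta\psi)+\frac1{\sin\theta}\partial_\alpha(\sin\theta\,O^{\alpha\beta}\partial_\beta\psi)$. On the transformed side $O$ denotes the same expression with $(w,\theta,\varphi)$ replaced by $(\widetilde w,\widetilde\theta,\widetilde\varphi)$. **Generalized Whiting transform.** For $\psi=\psi(w,r,\theta,\varphi)$ on $r\ge r_+$, $$\mathfrak W[\psi](\widetilde w,\widetilde r,\widetilde\theta,\widetilde\varphi)=\int_{r_+}^\infty\psi\big(\widetilde w+B(\widetilde r,r),r,\widetilde\theta,\widetilde\varphi\big)\,dr,\qquad B(\widetilde r,r)=S(\widetilde r-\widetilde R)(r-R).$$ Here $\psi$ is smooth in $(w,r,\theta,\varphi)$ up to $r=r_+$ and vanishes for $r$ large. **Horizon trace.** For a function $F$, $F_+(\widetilde w,\widetilde r,\widetilde\theta,\widetilde\varphi):=F\big(\widetilde w+B(\widetilde r,r_+),r_+,\widetilde\theta,\widetilde\varphi\big)$. *)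

theory Defs
  imports "HOL-Analysis.Analysis"
begin

text \<open>Coordinates \<open>(w, r, \<theta>, \<phi>)\<close> as a finite index type, so that points are vectors and
  rescaled inverse metrics are matrices indexed by coordinates.\<close>

datatype coord = cw | cr | cth | cph

instance coord :: finite
proof
  have "(UNIV :: coord set) = {cw, cr, cth, cph}"
    using coord.exhaust by blast
  then show "finite (UNIV :: coord set)"
    by (metis finite.emptyI finite.insertI)
qed

type_synonym point = "real ^ coord"
type_synonym tensor = "real ^ coord ^ coord"

definition mk_point :: "real \<Rightarrow> real \<Rightarrow> real \<Rightarrow> real \<Rightarrow> point" where
  "mk_point w r \<theta> \<phi> =
     (\<chi> i. case i of cw \<Rightarrow> w | cr \<Rightarrow> r | cth \<Rightarrow> \<theta> | cph \<Rightarrow> \<phi>)"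

text \<open>Derivatives are taken within the domain \<open>D\<close>, hence are one-sided at boundary points
  belonging to \<open>D\<close> and the usual ones at interior points.\<close>

definition pd :: "coord \<Rightarrow> point set \<Rightarrow> (point \<Rightarrow> 'b::real_normed_vector) \<Rightarrow> point \<Rightarrow> 'b" where
  "pd i D f x = frechet_derivative f (at x within D) (axis i 1)"

primrec Ck_on :: "nat \<Rightarrow> point set \<Rightarrow> (point \<Rightarrow> 'b::real_normed_vector) \<Rightarrow> bool" where
  "Ck_on 0 D f \<longleftrightarrow> continuous_on D f"
| "Ck_on (Suc k) D f \<longleftrightarrow> f differentiable_on D \<and> (\<forall>i. Ck_on k D (pd i D f))"

definition smooth_upto :: "point set \<Rightarrow> (point \<Rightarrow> 'b::real_normed_vector) \<Rightarrow> bool" where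
  "smooth_upto D f \<longleftrightarrow> (\<forall>k. Ck_on k D f)"

text \<open>The wave operator \<open>|g|\<^sup>-\<^sup>1\<^sup>/\<^sup>2 \<partial>\<^sub>\<alpha> (|g|\<^sup>1\<^sup>/\<^sup>2 g\<^sup>\<alpha>\<^sup>\<beta> \<partial>\<^sub>\<beta> \<psi>)\<close> of a metric given by its
  inverse metric \<open>G\<close>, so that \<open>|g|\<^sup>1\<^sup>/\<^sup>2 = |det G|\<^sup>-\<^sup>1\<^sup>/\<^sup>2\<close>. Meaningful only where \<open>det G \<noteq> 0\<close>.\<close>

definition vol_density :: "(point \<Rightarrow> tensor) \<Rightarrow> point \<Rightarrow> real" where
  "vol_density G x = 1 / sqrt \<bar>det (G x)\<bar>"

definition wave_op :: "point set \<Rightarrow> (point \<Rightarrow> tensor) \<Rightarrow> (point \<Rightarrow> complex) \<Rightarrow> point \<Rightarrow> complex" where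
  "wave_op D G \<psi> x =
     (1 / vol_density G x) *\<^sub>R
       (\<Sum>\<alpha>\<in>UNIV. pd \<alpha> D
          (\<lambda>y. vol_density G y *\<^sub>R (\<Sum>\<beta>\<in>UNIV. (G y $ \<alpha> $ \<beta>) *\<^sub>R pd \<beta> D \<psi> y)) x)"

text \<open>The rescaled operator
  \<open>\<partial>\<^sub>\<alpha> (h\<^sup>\<alpha>\<^sup>\<beta> \<partial>\<^sub>\<beta> \<psi>) + (sin \<theta>)\<^sup>-\<^sup>1 \<partial>\<^sub>\<alpha> (sin \<theta> O\<^sup>\<alpha>\<^sup>\<beta> \<partial>\<^sub>\<beta> \<psi>)\<close>,
  where \<open>h\<close> depends on the radial coordinate only.\<close>

definition split_wave ::
  "point set \<Rightarrow> (real \<Rightarrow> tensor) \<Rightarrow> (point \<Rightarrow> tensor) \<Rightarrow> (point \<Rightarrow> complex) \<Rightarrow> point \<Rightarrow> complex" where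
  "split_wave D h Q \<psi> x =
     (\<Sum>\<alpha>\<in>UNIV. pd \<alpha> D (\<lambda>y. \<Sum>\<beta>\<in>UNIV. (h (y $ cr) $ \<alpha> $ \<beta>) *\<^sub>R pd \<beta> D \<psi> y) x)
     + (1 / sin (x $ cth)) *\<^sub>R
       (\<Sum>\<alpha>\<in>UNIV. pd \<alpha> D
          (\<lambda>y. sin (y $ cth) *\<^sub>R (\<Sum>\<beta>\<in>UNIV. (Q y $ \<alpha> $ \<beta>) *\<^sub>R pd \<beta> D \<psi> y)) x)"

definition kerr_Delta :: "real \<Rightarrow> real \<Rightarrow> real \<Rightarrow> real" where
  "kerr_Delta m a r = r\<^sup>2 - 2 * m * r + a\<^sup>2"

definition r_plus :: "real \<Rightarrow> real \<Rightarrow> real" where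
  "r_plus m a = m + sqrt (m\<^sup>2 - a\<^sup>2)"

definition kerr_q :: "real \<Rightarrow> point \<Rightarrow> complex" where
  "kerr_q a x = Complex (x $ cr) (a * cos (x $ cth))"

text \<open>The sign \<open>\<epsilon>\<close> is \<open>-1\<close> for outgoing and \<open>+1\<close> for ingoing Eddington-Finkelstein coordinates.\<close>

definition kerr_h :: "real \<Rightarrow> real \<Rightarrow> real \<Rightarrow> real \<Rightarrow> tensor" where
  "kerr_h m a \<epsilon> r = (\<chi> \<alpha> \<beta>. case (\<alpha>, \<beta>) of
       (cr, cr) \<Rightarrow> kerr_Delta m a r
     | (cw, cr) \<Rightarrow> \<epsilon> * (r\<^sup>2 + a\<^sup>2)
     | (cr, cw) \<Rightarrow> \<epsilon> * (r\<^sup>2 + a\<^sup>2)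
     | (cr, cph) \<Rightarrow> \<epsilon> * a
     | (cph, cr) \<Rightarrow> \<epsilon> * a
     | _ \<Rightarrow> 0)"

definition kerr_O :: "real \<Rightarrow> point \<Rightarrow> tensor" where
  "kerr_O a x =
     (let e = axis cth 1 :: point;
          V = (a * (sin (x $ cth))\<^sup>2) *\<^sub>R axis cw 1 + axis cph 1 :: point
      in \<chi> \<alpha> \<beta>. e $ \<alpha> * e $ \<beta> + 1 / (sin (x $ cth))\<^sup>2 * (V $ \<alpha> * V $ \<beta>))"

definition kerr_inverse_metric :: "real \<Rightarrow> real \<Rightarrow> real \<Rightarrow> point \<Rightarrow> tensor" where
  "kerr_inverse_metric m a \<epsilon> x =
     (1 / (cmod (kerr_q a x))\<^sup>2) *\<^sub>R (kerr_h m a \<epsilon> (x $ cr) + kerr_O a x)"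

text \<open>The exterior up to and including the horizon, and the coordinate domain of the transformed
  functions. The coordinate poles \<open>\<theta> = 0, \<pi>\<close> are excluded; \<open>\<phi>\<close> ranges over all reals, and
  \<open>2\<pi>\<close>-periodic functions are a special case.\<close>

definition kerr_dom :: "real \<Rightarrow> real \<Rightarrow> point set" where
  "kerr_dom m a = {x. r_plus m a \<le> x $ cr \<and> 0 < x $ cth \<and> x $ cth < pi}"

definition whiting_dom :: "point set" where
  "whiting_dom = {x. 0 < x $ cth \<and> x $ cth < pi}"

definition whiting_phase :: "real \<Rightarrow> real \<Rightarrow> real \<Rightarrow> real \<Rightarrow> real \<Rightarrow> real" where
  "whiting_phase S R Rt rt r = S * (rt - Rt) * (r - R)"

definition whiting ::
  "real \<Rightarrow> real \<Rightarrow> real \<Rightarrow> real \<Rightarrow> real \<Rightarrow> (point \<Rightarrow> complex) \<Rightarrow> point \<Rightarrow> complex" where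
  "whiting m a S R Rt \<psi> x =
     integral {r_plus m a..}
       (\<lambda>r. \<psi> (mk_point (x $ cw + whiting_phase S R Rt (x $ cr) r) r (x $ cth) (x $ cph)))"

definition horizon_trace ::
  "real \<Rightarrow> real \<Rightarrow> real \<Rightarrow> real \<Rightarrow> real \<Rightarrow> (point \<Rightarrow> complex) \<Rightarrow> point \<Rightarrow> complex" where
  "horizon_trace m a S R Rt F x =
     F (mk_point (x $ cw + whiting_phase S R Rt (x $ cr) (r_plus m a))
          (r_plus m a) (x $ cth) (x $ cph))"

definition horizon_term ::
  "real \<Rightarrow> real \<Rightarrow> real \<Rightarrow> real \<Rightarrow> real \<Rightarrow> real \<Rightarrow> (point \<Rightarrow> complex) \<Rightarrow> point \<Rightarrow> complex" where
  "horizon_term m a \<epsilon> S R Rt \<psi> x =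
     - (2 * kerr_h m a \<epsilon> (r_plus m a) $ cw $ cr)
         *\<^sub>R horizon_trace m a S R Rt (pd cw (kerr_dom m a) \<psi>) x
     - (2 * kerr_h m a \<epsilon> (r_plus m a) $ cr $ cph)
         *\<^sub>R horizon_trace m a S R Rt (pd cph (kerr_dom m a) \<psi>) x"

definition whiting_h :: "real \<Rightarrow> real \<Rightarrow> real \<Rightarrow> real \<Rightarrow> real \<Rightarrow> real \<Rightarrow> real \<Rightarrow> tensor" where
  "whiting_h m a \<epsilon> S R Rt rt =
     (let X = S * (rt - Rt);
          A\<^sub>R = R\<^sup>2 + a\<^sup>2;
          \<Delta>\<^sub>R = kerr_Delta m a R;
          \<Delta>\<^sub>R' = 2 * (R - m)
      in \<chi> \<alpha> \<beta>. case (\<alpha>, \<beta>) of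
           (cr, cr) \<Rightarrow> 1 / S\<^sup>2 * (X * (X - 2 * \<epsilon>))
         | (cw, cr) \<Rightarrow> 1 / S * (1/2 * \<Delta>\<^sub>R' * X\<^sup>2 - 2 * \<epsilon> * R * X)
         | (cr, cw) \<Rightarrow> 1 / S * (1/2 * \<Delta>\<^sub>R' * X\<^sup>2 - 2 * \<epsilon> * R * X)
         | (cw, cw) \<Rightarrow> \<Delta>\<^sub>R * X\<^sup>2 - 2 * \<epsilon> * A\<^sub>R * X
         | (cw, cph) \<Rightarrow> - (\<epsilon> * a * X)
         | (cph, cw) \<Rightarrow> - (\<epsilon> * a * X)
         | _ \<Rightarrow> 0)"

end

theory Submission
  imports Defs
begin

text \<open>Along the ray on which \<open>W[\<psi>]\<close> integrates, \<open>d/dr\<close> acts as \<open>\<partial>\<^sub>r + X \<partial>\<^sub>w\<close> with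
  \<open>X = S (rt - Rt)\<close>, so integration by parts turns \<open>\<partial>\<^sub>r\<close> under the integral into \<open>- X \<partial>\<^sub>w\<close> plus a
  horizon term, while \<open>\<partial>\<close> with respect to \<open>rt\<close> becomes multiplication by \<open>S (r - R)\<close> after \<open>\<partial>\<^sub>w\<close>. Hence
  both sides reduce to radial moments of \<open>\<partial>\<^sub>w\<^sup>2 \<psi>\<close> and \<open>\<partial>\<^sub>w \<psi>\<close> that agree by Taylor expansion of
  \<open>\<Delta>\<close> and \<open>r\<^sup>2 + a\<^sup>2\<close> at \<open>R\<close>. Since \<open>\<Delta>\<close> vanishes at the horizon, only the \<open>wr\<close> and
  \<open>r\<phi>\<close> components leave horizon terms. The conformal factor of the transformed metric is read off
  from \<open>det (h + O) = N / sin\<^sup>2 \<theta>\<close>: taking \<open>\<surd>\<bar>N\<bar>\<close> makes the wave operator split.\<close>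

subsection \<open>Derivatives within a domain\<close>

lemma UNIV_coord: "(UNIV :: coord set) = {cw, cr, cth, cph}"
  using coord.exhaust by blast

lemma sum_coord: "(\<Sum>i\<in>UNIV. f i) = f cw + f cr + f cth + (f cph :: 'a::comm_monoid_add)"
  by (simp add: UNIV_coord add.assoc)

text \<open>One-sided approach along each axis suffices for derivatives within the domain to be unique,
  also at the horizon.\<close>

definition coord_approachable :: "point set \<Rightarrow> bool" where
  "coord_approachable D \<longleftrightarrow>
     (\<forall>x\<in>D. \<forall>i. \<forall>e>0. \<exists>d. 0 < \<bar>d\<bar> \<and> \<bar>d\<bar> < e \<and> x + d *\<^sub>R axis i 1 \<in> D)"

text \<open>\<open>frechet_derivative\<close> is a choice among derivatives, so its value is known
  only once the derivative is unique. Approach along every axis inside \<open>D\<close> provides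
  that.\<close>

lemma pd_eq:
  assumes "coord_approachable D" "x \<in> D" "(f has_derivative f') (at x within D)"
  shows "pd i D f x = f' (axis i 1)"
proof -
  have "(f has_derivative frechet_derivative f (at x within D)) (at x within D)"
    using assms(3) frechet_derivative_works differentiable_def by blast
  then have "frechet_derivative f (at x within D) = f'"
    using assms(1,2) unfolding coord_approachable_def
    by (intro frechet_derivative_unique_within[OF _ assms(3)]) (auto simp: Basis_vec_def)
  then show ?thesis
    by (simp add: pd_def)
qed

text \<open>Both functions have the same derivatives at \<open>x\<close>, so the choice inside
  \<open>frechet_derivative\<close> falls on the same map. This makes \<open>pd\<close> local even
  where differentiability is unknown.\<close>

lemma pd_cong_near:
  assumes "x \<in> D" "open U" "x \<in> U" "\<And>y. y \<in> D \<Longrightarrow> y \<in> U \<Longrightarrow> f y = g y"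
  shows "pd i D f x = pd i D g x"
proof -
  have ev: "\<forall>\<^sub>F y in at x within D. f y = g y"
    using assms eventually_at_topological by blast
  have "(f has_derivative f') (at x within D) \<longleftrightarrow> (g has_derivative f') (at x within D)" for f'
    using has_derivative_transform_eventually[OF _ ev] assms
      has_derivative_transform_eventually[of g f' x D f] ev
    by (metis (mono_tags, lifting) eventually_mono)
  then show ?thesis
    by (simp add: pd_def frechet_derivative_def)
qed

lemma pd_cong:
  assumes "x \<in> D" "\<And>y. y \<in> D \<Longrightarrow> f y = g y"
  shows "pd i D f x = pd i D g x"
  by (rule pd_cong_near[of x D UNIV]) (use assms in auto)

lemma pd_vanish:
  assumes D: "coord_approachable D" "x \<in> D" and "open U" "x \<in> U"
    and "\<And>y. y \<in> D \<Longrightarrow> y \<in> U \<Longrightarrow> F y = 0"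
  shows "pd i D F x = 0"
  using pd_cong_near[OF D(2) assms(3-5)] pd_eq[OF D has_derivative_const] by simp

text \<open>Expanding a vector along the coordinate axes turns values on single axes into the full
  derivative that the chain rule needs.\<close>

lemma has_derivative_pd:
  fixes f :: "point \<Rightarrow> 'b::real_normed_vector"
  assumes "f differentiable (at x within D)"
  shows "(f has_derivative (\<lambda>v. \<Sum>i\<in>UNIV. v $ i *\<^sub>R pd i D f x)) (at x within D)"
proof -
  let ?f' = "frechet_derivative f (at x within D)"
  have f': "(f has_derivative ?f') (at x within D)"
    using assms frechet_derivative_works by blast
  then interpret bounded_linear ?f'
    by (rule has_derivative_bounded_linear)
  have "?f' v = (\<Sum>i\<in>UNIV. v $ i *\<^sub>R pd i D f x)" for v
  proof -
    have "?f' v = ?f' (\<Sum>i\<in>UNIV. v $ i *\<^sub>R axis i 1)"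
      using basis_expansion[of v] by (simp add: scalar_mult_eq_scaleR)
    then show ?thesis
      by (simp add: sum scaleR pd_def)
  qed
  then have "?f' = (\<lambda>v. \<Sum>i\<in>UNIV. v $ i *\<^sub>R pd i D f x)"
    by blast
  with f' show ?thesis
    by simp
qed

text \<open>The product rule in the shape of a divergence: \<open>k\<close> stands for a row of
  metric coefficients, \<open>F\<close> for the gradient of the field.\<close>

lemma pd_sum_scaleR:
  fixes F :: "'i \<Rightarrow> point \<Rightarrow> 'b::real_normed_vector"
  assumes D: "coord_approachable D" "x \<in> D"
    and k: "\<And>j. j \<in> J \<Longrightarrow> (k j has_derivative k' j) (at x within D)"
    and F: "\<And>j. j \<in> J \<Longrightarrow> F j differentiable (at x within D)"
  shows "pd i D (\<lambda>y. \<Sum>j\<in>J. k j y *\<^sub>R F j y) x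
    = (\<Sum>j\<in>J. k j x *\<^sub>R pd i D (F j) x + k' j (axis i 1) *\<^sub>R F j x)"
proof -
  have "((\<lambda>y. \<Sum>j\<in>J. k j y *\<^sub>R F j y) has_derivative
      (\<lambda>v. \<Sum>j\<in>J. k j x *\<^sub>R (\<Sum>l\<in>UNIV. v $ l *\<^sub>R pd l D (F j) x) + k' j v *\<^sub>R F j x)) (at x within D)"
    by (intro has_derivative_sum has_derivative_scaleR k has_derivative_pd F)
  from pd_eq[OF D this, of i] show ?thesis
    by (simp add: axis_def if_distrib[of "\<lambda>c. c *\<^sub>R _"] cong: if_cong)
qed

subsection \<open>Split wave operators\<close>

text \<open>Powers of the sine are cancelled in advance, which leaves functions of \<theta> alone
  for one-variable calculus. The table agrees with \<open>kerr_O\<close> off the poles.\<close>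

definition kerr_O_entry :: "real \<Rightarrow> coord \<Rightarrow> coord \<Rightarrow> real \<Rightarrow> real" where
  "kerr_O_entry a \<alpha> \<beta> \<theta> = (case (\<alpha>, \<beta>) of
       (cw, cw) \<Rightarrow> a\<^sup>2 * (sin \<theta>)\<^sup>2
     | (cw, cph) \<Rightarrow> a
     | (cph, cw) \<Rightarrow> a
     | (cph, cph) \<Rightarrow> 1 / (sin \<theta>)\<^sup>2
     | (cth, cth) \<Rightarrow> 1
     | _ \<Rightarrow> 0)"

lemma kerr_O_nth:
  assumes "sin (x $ cth) \<noteq> 0"
  shows "kerr_O a x $ \<alpha> $ \<beta> = kerr_O_entry a \<alpha> \<beta> (x $ cth)"
  using assms
  by (cases \<alpha>; cases \<beta>)
     (simp_all add: kerr_O_def kerr_O_entry_def Let_def axis_def power2_eq_square)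

definition kerr_O_entry_deriv :: "real \<Rightarrow> coord \<Rightarrow> coord \<Rightarrow> real \<Rightarrow> real" where
  "kerr_O_entry_deriv a \<alpha> \<beta> \<theta> = (case (\<alpha>, \<beta>) of
       (cw, cw) \<Rightarrow> 2 * a\<^sup>2 * sin \<theta> * cos \<theta>
     | (cph, cph) \<Rightarrow> - 2 * cos \<theta> / sin \<theta> ^ 3
     | _ \<Rightarrow> 0)"

lemma kerr_O_entry_deriv:
  assumes "sin \<theta> \<noteq> 0"
  shows "(kerr_O_entry a \<alpha> \<beta> has_real_derivative kerr_O_entry_deriv a \<alpha> \<beta> \<theta>) (at \<theta>)"
  unfolding kerr_O_entry_def[abs_def] kerr_O_entry_deriv_def using assms
  by (cases \<alpha>; cases \<beta>)
     (auto intro!: derivative_eq_intros simp: power2_eq_square power3_eq_cube field_simps)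

lemma has_derivative_coord_comp:
  assumes "(u has_real_derivative u') (at (x $ i))"
  shows "((\<lambda>y::point. u (y $ i)) has_derivative (\<lambda>v. u' * v $ i)) (at x within D)"
proof -
  have "((\<lambda>y::point. y $ i) has_derivative (\<lambda>v. v $ i)) (at x within D)"
    by (rule bounded_linear_imp_has_derivative) (rule bounded_linear_vec_nth)
  from has_derivative_compose[OF this, of u "(*) u'"] assms show ?thesis
    by (simp add: has_field_derivative_def)
qed

text \<open>Allows the transform to be replaced by its truncation to a bounded radial interval
  before any derivative is computed.\<close>

lemma split_wave_cong:
  assumes "x \<in> D" "\<And>y. y \<in> D \<Longrightarrow> f y = g y"
  shows "split_wave D h Q f x = split_wave D h Q g x"
proof -
  have pd: "pd \<beta> D f y = pd \<beta> D g y" if "y \<in> D" for \<beta> y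
    using pd_cong that assms(2) by blast
  show ?thesis
    unfolding split_wave_def
    by (intro arg_cong2[where f = "(+)"] arg_cong2[where f = "(*\<^sub>R)"] sum.cong refl pd_cong assms(1))
       (simp_all add: pd assms(2))
qed

text \<open>As \<open>h\<close> depends on \<open>r\<close> only, its derivative enters through the
  row \<open>cr\<close>; the only \<theta>-derivative falls on the row \<open>cth\<close> of
  \<open>kerr_O\<close>, where the sine weight produces the cotangent term. Mixed second derivatives
  appear in both orders, so no symmetry is invoked.\<close>

lemma split_wave_expand:
  fixes f :: "point \<Rightarrow> complex"
  assumes D: "coord_approachable D" "x \<in> D" and sin: "\<And>y. y \<in> D \<Longrightarrow> sin (y $ cth) \<noteq> 0"
    and f: "\<And>i. pd i D f differentiable (at x within D)"
    and h: "\<And>\<alpha> \<beta>. ((\<lambda>r. h r $ \<alpha> $ \<beta>) has_real_derivative h' \<alpha> \<beta>) (at (x $ cr))"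
  shows "split_wave D h (kerr_O a) f x =
     (\<Sum>\<alpha>\<in>UNIV. \<Sum>\<beta>\<in>UNIV. (h (x $ cr) $ \<alpha> $ \<beta>) *\<^sub>R pd \<alpha> D (pd \<beta> D f) x)
     + (\<Sum>\<beta>\<in>UNIV. h' cr \<beta> *\<^sub>R pd \<beta> D f x)
     + (pd cth D (pd cth D f) x + (cos (x $ cth) / sin (x $ cth)) *\<^sub>R pd cth D f x
        + (a\<^sup>2 * (sin (x $ cth))\<^sup>2) *\<^sub>R pd cw D (pd cw D f) x
        + a *\<^sub>R pd cw D (pd cph D f) x + a *\<^sub>R pd cph D (pd cw D f) x
        + (1 / (sin (x $ cth))\<^sup>2) *\<^sub>R pd cph D (pd cph D f) x)"
proof -
  let ?s = "sin (x $ cth)" and ?O = "kerr_O_entry a" and ?O' = "kerr_O_entry_deriv a"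
  have s: "?s \<noteq> 0"
    using D sin by blast
  have 1: "pd \<alpha> D (\<lambda>y. \<Sum>\<beta>\<in>UNIV. (h (y $ cr) $ \<alpha> $ \<beta>) *\<^sub>R pd \<beta> D f y) x
      = (\<Sum>\<beta>\<in>UNIV. (h (x $ cr) $ \<alpha> $ \<beta>) *\<^sub>R pd \<alpha> D (pd \<beta> D f) x
          + (h' \<alpha> \<beta> * axis \<alpha> 1 $ cr) *\<^sub>R pd \<beta> D f x)" for \<alpha>
    by (rule pd_sum_scaleR[OF D has_derivative_coord_comp[OF h] f])
  have 2: "pd \<alpha> D (\<lambda>y. sin (y $ cth) *\<^sub>R (\<Sum>\<beta>\<in>UNIV. (kerr_O a y $ \<alpha> $ \<beta>) *\<^sub>R pd \<beta> D f y)) x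
      = (\<Sum>\<beta>\<in>UNIV. (?s * ?O \<alpha> \<beta> (x $ cth)) *\<^sub>R pd \<alpha> D (pd \<beta> D f) x
          + ((cos (x $ cth) * ?O \<alpha> \<beta> (x $ cth) + ?O' \<alpha> \<beta> (x $ cth) * ?s) * axis \<alpha> 1 $ cth)
             *\<^sub>R pd \<beta> D f x)" (is "_ = ?R \<alpha>") for \<alpha>
  proof -
    have k: "((\<lambda>\<theta>. sin \<theta> * ?O \<alpha> \<beta> \<theta>) has_real_derivative
        cos (x $ cth) * ?O \<alpha> \<beta> (x $ cth) + ?O' \<alpha> \<beta> (x $ cth) * ?s) (at (x $ cth))" for \<beta>
      by (intro DERIV_mult DERIV_sin kerr_O_entry_deriv s)
    have "pd \<alpha> D (\<lambda>y. sin (y $ cth) *\<^sub>R (\<Sum>\<beta>\<in>UNIV. (kerr_O a y $ \<alpha> $ \<beta>) *\<^sub>R pd \<beta> D f y)) x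
        = pd \<alpha> D (\<lambda>y. \<Sum>\<beta>\<in>UNIV. (sin (y $ cth) * ?O \<alpha> \<beta> (y $ cth)) *\<^sub>R pd \<beta> D f y) x"
      by (rule pd_cong[OF D(2)]) (simp add: scaleR_sum_right kerr_O_nth sin)
    also have "\<dots> = ?R \<alpha>"
      by (rule pd_sum_scaleR[OF D has_derivative_coord_comp[OF k] f])
    finally show ?thesis .
  qed
  show ?thesis
    unfolding split_wave_def 1 2 using s
    by (simp add: sum_coord axis_def kerr_O_entry_def kerr_O_entry_deriv_def scaleR_add_right algebra_simps)
qed

text \<open>The sine depends on \<theta> only and \<open>h\<close> has no flux in that direction, so
  the weight moves through the divergence of the \<open>h\<close> part unchanged.\<close>

lemma split_wave_eq_divergence:
  fixes f :: "point \<Rightarrow> complex"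
  assumes D: "coord_approachable D" "x \<in> D" and sin: "\<And>y. y \<in> D \<Longrightarrow> sin (y $ cth) \<noteq> 0"
    and f: "\<And>i. pd i D f differentiable (at x within D)"
    and h: "\<And>\<alpha> \<beta>. ((\<lambda>r. h r $ \<alpha> $ \<beta>) has_real_derivative h' \<alpha> \<beta>) (at (x $ cr))"
    and h_th: "\<And>r \<beta>. h r $ cth $ \<beta> = 0"
  shows "split_wave D h (kerr_O a) f x =
     (1 / sin (x $ cth)) *\<^sub>R
       (\<Sum>\<alpha>\<in>UNIV. pd \<alpha> D
          (\<lambda>y. sin (y $ cth) *\<^sub>R (\<Sum>\<beta>\<in>UNIV. ((h (y $ cr) + kerr_O a y) $ \<alpha> $ \<beta>) *\<^sub>R pd \<beta> D f y)) x)"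
proof -
  let ?s = "sin (x $ cth)" and ?O = "kerr_O_entry a" and ?O' = "kerr_O_entry_deriv a"
  let ?c = "cos (x $ cth)"
  have s: "?s \<noteq> 0"
    using D sin by blast
  have 2: "pd \<alpha> D (\<lambda>y. sin (y $ cth) *\<^sub>R (\<Sum>\<beta>\<in>UNIV. ((h (y $ cr) + kerr_O a y) $ \<alpha> $ \<beta>) *\<^sub>R pd \<beta> D f y)) x
      = (\<Sum>\<beta>\<in>UNIV. (?s * (h (x $ cr) $ \<alpha> $ \<beta> + ?O \<alpha> \<beta> (x $ cth))) *\<^sub>R pd \<alpha> D (pd \<beta> D f) x
          + (?s * (h' \<alpha> \<beta> * axis \<alpha> 1 $ cr + ?O' \<alpha> \<beta> (x $ cth) * axis \<alpha> 1 $ cth)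
             + ?c * axis \<alpha> 1 $ cth * (h (x $ cr) $ \<alpha> $ \<beta> + ?O \<alpha> \<beta> (x $ cth)))
             *\<^sub>R pd \<beta> D f x)" (is "_ = ?R \<alpha>") for \<alpha>
  proof -
    have k: "((\<lambda>y::point. sin (y $ cth) * (h (y $ cr) $ \<alpha> $ \<beta> + ?O \<alpha> \<beta> (y $ cth))) has_derivative
        (\<lambda>v. ?s * (h' \<alpha> \<beta> * v $ cr + ?O' \<alpha> \<beta> (x $ cth) * v $ cth)
             + ?c * v $ cth * (h (x $ cr) $ \<alpha> $ \<beta> + ?O \<alpha> \<beta> (x $ cth)))) (at x within D)" for \<beta>
      by (intro has_derivative_mult has_derivative_add has_derivative_coord_comp h
          kerr_O_entry_deriv s DERIV_sin)
    have "pd \<alpha> D (\<lambda>y. sin (y $ cth) *\<^sub>R (\<Sum>\<beta>\<in>UNIV. ((h (y $ cr) + kerr_O a y) $ \<alpha> $ \<beta>) *\<^sub>R pd \<beta> D f y)) x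
        = pd \<alpha> D (\<lambda>y. \<Sum>\<beta>\<in>UNIV. (sin (y $ cth) * (h (y $ cr) $ \<alpha> $ \<beta> + ?O \<alpha> \<beta> (y $ cth))) *\<^sub>R pd \<beta> D f y) x"
      by (rule pd_cong[OF D(2)]) (simp add: scaleR_sum_right kerr_O_nth sin)
    also have "\<dots> = ?R \<alpha>"
      by (rule pd_sum_scaleR[OF D k f])
    finally show ?thesis .
  qed
  have h'_th: "h' cth \<beta> = 0" for \<beta>
    using h[of cth \<beta>] DERIV_unique[OF _ DERIV_const[of 0]] by (simp add: h_th)
  note expand = split_wave_expand[where h = h and h' = h' and a = a, OF D sin f h, simplified]
  show ?thesis
    unfolding 2 using s
    by (simp add: expand sum_coord axis_def kerr_O_entry_def kerr_O_entry_deriv_def scaleR_add_right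
        scaleR_add_left h_th h'_th distrib_left add_divide_distrib)
qed

text \<open>The volume density carries a factor \<rho> and the inverse metric its reciprocal: inside
  the divergence they cancel and the sine remains. No derivative of \<rho> occurs, and the relations
  are asked only near \<open>x\<close>, which admits metrics that degenerate elsewhere.\<close>

lemma wave_op_eq_split_wave:
  fixes f :: "point \<Rightarrow> complex"
  assumes D: "coord_approachable D" "x \<in> D" and sin: "\<And>y. y \<in> D \<Longrightarrow> sin (y $ cth) \<noteq> 0"
    and f: "\<And>i. pd i D f differentiable (at x within D)"
    and h: "\<And>\<alpha> \<beta>. ((\<lambda>r. h r $ \<alpha> $ \<beta>) has_real_derivative h' \<alpha> \<beta>) (at (x $ cr))"
    and h_th: "\<And>r \<beta>. h r $ cth $ \<beta> = 0"
    and U: "open U" "x \<in> U"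
    and G: "\<And>y. y \<in> D \<inter> U \<Longrightarrow> \<rho> y *\<^sub>R G y = h (y $ cr) + kerr_O a y"
    and vol: "\<And>y. y \<in> D \<inter> U \<Longrightarrow> vol_density G y = \<rho> y * sin (y $ cth)"
    and \<rho>: "\<rho> x \<noteq> 0"
  shows "\<rho> x *\<^sub>R wave_op D G f x = split_wave D h (kerr_O a) f x"
proof -
  have "pd \<alpha> D (\<lambda>y. vol_density G y *\<^sub>R (\<Sum>\<beta>\<in>UNIV. (G y $ \<alpha> $ \<beta>) *\<^sub>R pd \<beta> D f y)) x
      = pd \<alpha> D (\<lambda>y. sin (y $ cth) *\<^sub>R (\<Sum>\<beta>\<in>UNIV. ((h (y $ cr) + kerr_O a y) $ \<alpha> $ \<beta>) *\<^sub>R pd \<beta> D f y)) x" for \<alpha>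
  proof (rule pd_cong_near[OF D(2) U])
    fix y assume y: "y \<in> D" "y \<in> U"
    then have "(h (y $ cr) + kerr_O a y) $ \<alpha> $ \<beta> = \<rho> y * G y $ \<alpha> $ \<beta>" for \<beta>
      by (metis G Int_iff vector_scaleR_component real_scaleR_def)
    then show "vol_density G y *\<^sub>R (\<Sum>\<beta>\<in>UNIV. (G y $ \<alpha> $ \<beta>) *\<^sub>R pd \<beta> D f y)
      = sin (y $ cth) *\<^sub>R (\<Sum>\<beta>\<in>UNIV. ((h (y $ cr) + kerr_O a y) $ \<alpha> $ \<beta>) *\<^sub>R pd \<beta> D f y)"
      using y by (simp add: vol scaleR_sum_right mult_ac)
  qed
  then show ?thesis
    using split_wave_eq_divergence[where h = h and h' = h' and a = a, OF D sin f h h_th]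
      vol[of x] D U \<rho> by (simp add: wave_op_def)
qed

subsection \<open>Determinants and conformal factors\<close>

text \<open>The \<theta> direction decouples, which leaves a 3 by 3 determinant in
  \<open>cw\<close>, \<open>cr\<close>, \<open>cph\<close>.\<close>

lemma det_coord:
  fixes A :: "'a::comm_ring_1 ^ coord ^ coord"
  assumes "\<And>i. i \<noteq> cth \<Longrightarrow> A $ i $ cth = 0" and "\<And>i. i \<noteq> cth \<Longrightarrow> A $ cth $ i = 0"
  shows "det A = A $ cth $ cth *
    (A $ cw $ cw * (A $ cr $ cr * A $ cph $ cph - A $ cr $ cph * A $ cph $ cr)
     - A $ cw $ cr * (A $ cr $ cw * A $ cph $ cph - A $ cr $ cph * A $ cph $ cw)
     + A $ cw $ cph * (A $ cr $ cw * A $ cph $ cr - A $ cr $ cr * A $ cph $ cw))"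
proof -
  have f1: "finite {cw, cr, cph}" "cth \<notin> {cw, cr, cph}"
    and f2: "finite {cr, cph}" "cw \<notin> {cr, cph}" and f3: "finite {cph}" "cr \<notin> {cph}"
    by auto
  \<comment> \<open>The order of insertion fixes which index each expansion peels off; the decoupled
    one goes first.\<close>
  have U: "UNIV = {cth, cw, cr, cph}"
    by (auto simp: UNIV_coord)
  show ?thesis
    unfolding det_def U
    unfolding sum_over_permutations_insert[OF f1] sum_over_permutations_insert[OF f2]
      sum_over_permutations_insert[OF f3] permutes_sing
    by (simp add: sign_swap_id permutation_swap_id permutation_compose sign_compose sign_id swap_id_eq assms
        algebra_simps)
qed

lemma kerr_O_entry_offdiag:
  "i \<noteq> cth \<Longrightarrow> kerr_O_entry a i cth \<theta> = 0" "i \<noteq> cth \<Longrightarrow> kerr_O_entry a cth i \<theta> = 0"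
  by (cases i; simp add: kerr_O_entry_def)+

lemma det_scaleR_coord:
  fixes M :: tensor
  shows "det (k *\<^sub>R M) = k ^ 4 * det M"
proof -
  have "k *\<^sub>R M = (\<chi> i. k *s M $ i)"
    by (simp add: vec_eq_iff)
  moreover have "CARD(coord) = 4"
    by (simp add: UNIV_coord)
  ultimately show ?thesis
    using det_rows_mul[of "\<lambda>_. k" "\<lambda>i. M $ i"] by simp
qed

text \<open>In dimension four the scaling divides the determinant by \<open>\<rho> ^ 4\<close>, so
  its absolute value becomes the inverse square of \<rho> times the sine.\<close>

lemma vol_density_scaled:
  assumes "\<rho> > 0" "sin (x $ cth) > 0" "G x = (1 / \<rho>) *\<^sub>R M"
    and "\<bar>det M\<bar> = (\<rho> / sin (x $ cth))\<^sup>2"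
  shows "vol_density G x = \<rho> * sin (x $ cth)"
proof -
  have "det (G x) = (1 / \<rho>) ^ 4 * det M"
    by (simp only: assms(3) det_scaleR_coord)
  then have "\<bar>det (G x)\<bar> = (1 / (\<rho> * sin (x $ cth)))\<^sup>2"
    using assms(1,2) by (simp add: abs_mult assms(4)) (simp add: field_simps eval_nat_numeral)
  moreover have "1 / (\<rho> * sin (x $ cth)) > 0"
    using assms by simp
  ultimately show ?thesis
    using assms(1,2) by (simp add: vol_density_def del: power_divide power_mult_distrib)
qed

section \<open>Components of the radial tensors and their radial derivatives\<close>

lemma kerr_h_simps:
  "kerr_h m a \<epsilon> r $ cr $ cr = kerr_Delta m a r"
  "kerr_h m a \<epsilon> r $ cw $ cr = \<epsilon> * (r\<^sup>2 + a\<^sup>2)"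
  "kerr_h m a \<epsilon> r $ cr $ cw = \<epsilon> * (r\<^sup>2 + a\<^sup>2)"
  "kerr_h m a \<epsilon> r $ cr $ cph = \<epsilon> * a"
  "kerr_h m a \<epsilon> r $ cph $ cr = \<epsilon> * a"
  "kerr_h m a \<epsilon> r $ cth $ i = 0"
  "kerr_h m a \<epsilon> r $ i $ cth = 0"
  "kerr_h m a \<epsilon> r $ cw $ cw = 0"
  "kerr_h m a \<epsilon> r $ cw $ cph = 0"
  "kerr_h m a \<epsilon> r $ cph $ cw = 0"
  "kerr_h m a \<epsilon> r $ cph $ cph = 0"
  by (cases i; simp add: kerr_h_def)+

lemma whiting_h_simps:
  "whiting_h m a \<epsilon> S R Rt rt $ cr $ cr
    = 1 / S\<^sup>2 * (S * (rt - Rt) * (S * (rt - Rt) - 2 * \<epsilon>))"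
  "whiting_h m a \<epsilon> S R Rt rt $ cw $ cr
    = 1 / S * ((R - m) * (S * (rt - Rt))\<^sup>2 - 2 * \<epsilon> * R * (S * (rt - Rt)))"
  "whiting_h m a \<epsilon> S R Rt rt $ cr $ cw
    = 1 / S * ((R - m) * (S * (rt - Rt))\<^sup>2 - 2 * \<epsilon> * R * (S * (rt - Rt)))"
  "whiting_h m a \<epsilon> S R Rt rt $ cw $ cw
    = kerr_Delta m a R * (S * (rt - Rt))\<^sup>2 - 2 * \<epsilon> * (R\<^sup>2 + a\<^sup>2) * (S * (rt - Rt))"
  "whiting_h m a \<epsilon> S R Rt rt $ cw $ cph = - (\<epsilon> * a * (S * (rt - Rt)))"
  "whiting_h m a \<epsilon> S R Rt rt $ cph $ cw = - (\<epsilon> * a * (S * (rt - Rt)))"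
  "whiting_h m a \<epsilon> S R Rt rt $ cth $ i = 0"
  "whiting_h m a \<epsilon> S R Rt rt $ i $ cth = 0"
  "whiting_h m a \<epsilon> S R Rt rt $ cr $ cph = 0"
  "whiting_h m a \<epsilon> S R Rt rt $ cph $ cr = 0"
  "whiting_h m a \<epsilon> S R Rt rt $ cph $ cph = 0"
  by (cases i; simp add: whiting_h_def Let_def)+

definition kerr_h_deriv :: "real \<Rightarrow> real \<Rightarrow> real \<Rightarrow> coord \<Rightarrow> coord \<Rightarrow> real" where
  "kerr_h_deriv m \<epsilon> r \<alpha> \<beta> = (case (\<alpha>, \<beta>) of
       (cr, cr) \<Rightarrow> 2 * (r - m)
     | (cw, cr) \<Rightarrow> 2 * \<epsilon> * r
     | (cr, cw) \<Rightarrow> 2 * \<epsilon> * r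
     | _ \<Rightarrow> 0)"

lemma kerr_h_deriv:
  "((\<lambda>r. kerr_h m a \<epsilon> r $ \<alpha> $ \<beta>) has_real_derivative kerr_h_deriv m \<epsilon> r \<alpha> \<beta>) (at r)"
  by (cases \<alpha>; cases \<beta>)
     (auto intro!: derivative_eq_intros simp: kerr_h_simps kerr_h_deriv_def kerr_Delta_def)

definition whiting_h_deriv ::
  "real \<Rightarrow> real \<Rightarrow> real \<Rightarrow> real \<Rightarrow> real \<Rightarrow> real \<Rightarrow> real \<Rightarrow> coord \<Rightarrow> coord \<Rightarrow> real" where
  "whiting_h_deriv m a \<epsilon> S R Rt rt \<alpha> \<beta> = (let X = S * (rt - Rt) in case (\<alpha>, \<beta>) of
       (cr, cr) \<Rightarrow> 2 * (X - \<epsilon>) / S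
     | (cw, cr) \<Rightarrow> 2 * (R - m) * X - 2 * \<epsilon> * R
     | (cr, cw) \<Rightarrow> 2 * (R - m) * X - 2 * \<epsilon> * R
     | (cw, cw) \<Rightarrow> S * (2 * kerr_Delta m a R * X - 2 * \<epsilon> * (R\<^sup>2 + a\<^sup>2))
     | (cw, cph) \<Rightarrow> - (\<epsilon> * a * S)
     | (cph, cw) \<Rightarrow> - (\<epsilon> * a * S)
     | _ \<Rightarrow> 0)"

lemma whiting_h_deriv:
  assumes "S \<noteq> 0"
  shows "((\<lambda>r. whiting_h m a \<epsilon> S R Rt r $ \<alpha> $ \<beta>) has_real_derivative
    whiting_h_deriv m a \<epsilon> S R Rt rt \<alpha> \<beta>) (at rt)"
  using assms
  by (cases \<alpha>; cases \<beta>)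
     (auto intro!: derivative_eq_intros simp: whiting_h_simps whiting_h_deriv_def Let_def
        field_simps power2_eq_square)

section \<open>The two coordinate domains and the horizon\<close>

lemma sin_th_pos:
  "x \<in> kerr_dom m a \<Longrightarrow> sin (x $ cth) > 0"
  "x \<in> whiting_dom \<Longrightarrow> sin (x $ cth) > 0"
  by (auto simp: kerr_dom_def whiting_dom_def intro: sin_gt_zero)

text \<open>Both domains survive small positive steps along every axis: \<open>r\<close> has no
  upper bound, and only the bound \<theta> < \<open>pi\<close> limits the step.\<close>

lemma coord_approachableI:
  assumes "\<And>x d i. x \<in> D \<Longrightarrow> 0 < d \<Longrightarrow> d < pi - x $ cth \<Longrightarrow> x + d *\<^sub>R axis i 1 \<in> D"
    and "\<And>x. x \<in> D \<Longrightarrow> x $ cth < pi"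
  shows "coord_approachable D"
  unfolding coord_approachable_def
proof (intro ballI allI impI)
  fix x i and e :: real assume x: "x \<in> D" and e: "e > 0"
  define d where "d = min e (pi - x $ cth) / 2"
  have "0 < d" "d < e" "d < pi - x $ cth"
    using assms(2)[OF x] e by (auto simp: d_def min_def)
  with assms(1)[OF x] show "\<exists>d. 0 < \<bar>d\<bar> \<and> \<bar>d\<bar> < e \<and> x + d *\<^sub>R axis i 1 \<in> D"
    by (intro exI[of _ d]) auto
qed

lemma coord_approachable_kerr_dom: "coord_approachable (kerr_dom m a)"
  by (rule coord_approachableI) (auto simp: kerr_dom_def axis_def)

lemma coord_approachable_whiting_dom: "coord_approachable whiting_dom"
  by (rule coord_approachableI) (auto simp: whiting_dom_def axis_def)

lemma kerr_Delta_r_plus: "\<bar>a\<bar> < m \<Longrightarrow> kerr_Delta m a (r_plus m a) = 0"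
proof -
  assume "\<bar>a\<bar> < m"
  then have "a\<^sup>2 \<le> m\<^sup>2"
    by (simp add: abs_le_square_iff[symmetric])
  then have "(sqrt (m\<^sup>2 - a\<^sup>2))\<^sup>2 = m\<^sup>2 - a\<^sup>2"
    by simp
  then show ?thesis
    by (simp add: kerr_Delta_def r_plus_def power2_eq_square algebra_simps)
qed

text \<open>The real part of \<open>kerr_q\<close> is at least \<open>r_plus m a\<close>, which is
  positive, so the ring singularity lies outside the domain.\<close>

lemma kerr_q_pos:
  assumes "m > 0" "y \<in> kerr_dom m a" "\<bar>a\<bar> < m"
  shows "(cmod (kerr_q a y))\<^sup>2 > 0"
proof -
  have "r_plus m a > 0"
    using assms(1,3) by (simp add: r_plus_def add_pos_nonneg abs_le_square_iff[symmetric] less_imp_le)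
  then show ?thesis
    using assms(2) by (auto simp: kerr_dom_def kerr_q_def complex_eq_iff)
qed

text \<open>The two terms containing \<open>kerr_Delta\<close> cancel, so the determinant stays
  nonzero on the horizon; the rest is minus a perfect square.\<close>

lemma det_kerr:
  assumes "sin (x $ cth) \<noteq> 0" "\<epsilon>\<^sup>2 = 1"
  shows "det (kerr_h m a \<epsilon> (x $ cr) + kerr_O a x)
    = - ((cmod (kerr_q a x))\<^sup>2 / sin (x $ cth))\<^sup>2"
proof -
  let ?s = "sin (x $ cth)" and ?A = "(x $ cr)\<^sup>2 + a\<^sup>2"
  have q: "(cmod (kerr_q a x))\<^sup>2 = ?A - a\<^sup>2 * ?s\<^sup>2"
    by (simp add: kerr_q_def cmod_power2 power_mult_distrib cos_squared_eq algebra_simps)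
  have "det (kerr_h m a \<epsilon> (x $ cr) + kerr_O a x) =
      a\<^sup>2 * ?s\<^sup>2 * (kerr_Delta m a (x $ cr) * (1 / ?s\<^sup>2) - \<epsilon> * a * (\<epsilon> * a))
      - \<epsilon> * ?A * (\<epsilon> * ?A * (1 / ?s\<^sup>2) - \<epsilon> * a * a)
      + a * (\<epsilon> * ?A * (\<epsilon> * a) - kerr_Delta m a (x $ cr) * a)"
    using assms(1) by (subst det_coord)
      (simp_all add: kerr_O_nth kerr_O_entry_offdiag kerr_h_simps, simp add: kerr_O_entry_def)
  also have "\<dots> = a\<^sup>2 * kerr_Delta m a (x $ cr) - \<epsilon>\<^sup>2 * a ^ 4 * ?s\<^sup>2 - \<epsilon>\<^sup>2 * ?A\<^sup>2 / ?s\<^sup>2 + \<epsilon>\<^sup>2 * ?A * a\<^sup>2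
      + \<epsilon>\<^sup>2 * ?A * a\<^sup>2 - kerr_Delta m a (x $ cr) * a\<^sup>2"
    using assms(1) by (simp add: right_diff_distrib power2_eq_square power4_eq_xxxx)
  also have "\<dots> = - ((cmod (kerr_q a x))\<^sup>2 / ?s)\<^sup>2"
    unfolding q assms(2) using assms(1) by (simp add: power_divide) (simp add: field_simps eval_nat_numeral)
  finally show ?thesis .
qed

text \<open>This is the squared sine times the determinant of the transformed rescaled inverse
  metric. It vanishes at \<open>X = 0\<close> and, for \<open>a \<noteq> 0\<close>, takes both
  signs: here the metric degenerates or changes signature.\<close>

definition whiting_disc ::
  "real \<Rightarrow> real \<Rightarrow> real \<Rightarrow> real \<Rightarrow> real \<Rightarrow> point \<Rightarrow> real" where
  "whiting_disc m a \<epsilon> S Rt x = (let X = S * (x $ cr - Rt) in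
     (X / S)\<^sup>2 * (a\<^sup>2 * (cos (x $ cth))\<^sup>2 * (X - 2 * \<epsilon>)\<^sup>2 - m\<^sup>2 * X\<^sup>2))"

lemma det_whiting:
  assumes "sin (x $ cth) \<noteq> 0" "\<epsilon>\<^sup>2 = 1" "S \<noteq> 0"
  shows "det (whiting_h m a \<epsilon> S R Rt (x $ cr) + kerr_O a x)
    = whiting_disc m a \<epsilon> S Rt x / (sin (x $ cth))\<^sup>2"
proof -
  let ?s = "sin (x $ cth)" and ?\<Delta> = "kerr_Delta m a R"
  \<comment> \<open>\<open>T\<close>, \<open>Q\<close> and \<open>P\<close> below are the
    \<open>rr\<close>, \<open>wr\<close> and \<open>ww\<close> components of
    \<open>whiting_h\<close>.\<close>
  define X where "X = S * (x $ cr - Rt)"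
  define T where "T = 1 / S\<^sup>2 * (X * (X - 2 * \<epsilon>))"
  define Q where "Q = 1 / S * ((R - m) * X\<^sup>2 - 2 * \<epsilon> * R * X)"
  define P where "P = ?\<Delta> * X\<^sup>2 - 2 * \<epsilon> * (R\<^sup>2 + a\<^sup>2) * X"
  have "det (whiting_h m a \<epsilon> S R Rt (x $ cr) + kerr_O a x) =
      (P + a\<^sup>2 * ?s\<^sup>2) * (T * (1 / ?s\<^sup>2)) - Q * (Q * (1 / ?s\<^sup>2)) - (a - \<epsilon> * a * X) * (T * (a - \<epsilon> * a * X))"
    using assms(1) by (subst det_coord)
      (simp_all add: kerr_O_nth kerr_O_entry_offdiag whiting_h_simps, simp add: kerr_O_entry_def P_def T_def Q_def X_def)
  also have "\<dots> = (P * T - Q * Q + a\<^sup>2 * ?s\<^sup>2 * T * (2 * \<epsilon> * X - \<epsilon>\<^sup>2 * X\<^sup>2)) / ?s\<^sup>2"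
    using assms(1) by (simp add: field_simps power2_eq_square)
  also have "P * T - Q * Q + a\<^sup>2 * ?s\<^sup>2 * T * (2 * \<epsilon> * X - \<epsilon>\<^sup>2 * X\<^sup>2)
      = (X / S)\<^sup>2 * ((X - 2 * \<epsilon>) * (?\<Delta> * X - 2 * \<epsilon> * (R\<^sup>2 + a\<^sup>2)) - ((R - m) * X - 2 * \<epsilon> * R)\<^sup>2
         - a\<^sup>2 * ?s\<^sup>2 * (X - 2 * \<epsilon>) * (\<epsilon>\<^sup>2 * X - 2 * \<epsilon>))"
    using assms(3) by (simp add: P_def Q_def T_def power_divide) (simp add: field_simps power2_eq_square)
  \<comment> \<open>All dependence on \<open>R\<close> cancels here, because the coefficients are
    Taylor data of \<open>kerr_Delta\<close> and \<open>r\<^sup>2 + a\<^sup>2\<close> at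
    \<open>R\<close>; \<open>\<epsilon>\<^sup>2 = 1\<close> merges the last two factors into a
    square.\<close>
  also have "(X - 2 * \<epsilon>) * (?\<Delta> * X - 2 * \<epsilon> * (R\<^sup>2 + a\<^sup>2)) - ((R - m) * X - 2 * \<epsilon> * R)\<^sup>2
         - a\<^sup>2 * ?s\<^sup>2 * (X - 2 * \<epsilon>) * (\<epsilon>\<^sup>2 * X - 2 * \<epsilon>)
      = a\<^sup>2 * (1 - ?s\<^sup>2) * (X - 2 * \<epsilon>)\<^sup>2 - m\<^sup>2 * X\<^sup>2"
    unfolding assms(2) by (simp add: kerr_Delta_def) (simp add: algebra_simps power2_eq_square)
  finally show ?thesis
    by (simp add: whiting_disc_def Let_def X_def cos_squared_eq)
qed

text \<open>By \<open>det_kerr\<close> the conformal factor fits on the whole domain, so the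
  neighbourhood can be all of space.\<close>

lemma kerr_wave_op_eq_split_wave:
  assumes "m > 0" "\<bar>a\<bar> < m" "\<epsilon>\<^sup>2 = 1" and y: "y \<in> kerr_dom m a"
    and "\<And>i. pd i (kerr_dom m a) \<psi> differentiable (at y within kerr_dom m a)"
  shows "(cmod (kerr_q a y))\<^sup>2 *\<^sub>R wave_op (kerr_dom m a) (kerr_inverse_metric m a \<epsilon>) \<psi> y
    = split_wave (kerr_dom m a) (kerr_h m a \<epsilon>) (kerr_O a) \<psi> y"
proof (rule wave_op_eq_split_wave[OF coord_approachable_kerr_dom y _ assms(5) kerr_h_deriv _ open_UNIV])
  fix z assume "z \<in> kerr_dom m a \<inter> UNIV"
  then have z: "z \<in> kerr_dom m a" by simp
  note q = kerr_q_pos[OF assms(1) z assms(2)]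
  show "(cmod (kerr_q a z))\<^sup>2 *\<^sub>R kerr_inverse_metric m a \<epsilon> z = kerr_h m a \<epsilon> (z $ cr) + kerr_O a z"
    using q by (simp add: kerr_inverse_metric_def)
  show "vol_density (kerr_inverse_metric m a \<epsilon>) z = (cmod (kerr_q a z))\<^sup>2 * sin (z $ cth)"
    using sin_th_pos(1)[OF z]
    by (intro vol_density_scaled[where M = "kerr_h m a \<epsilon> (z $ cr) + kerr_O a z", OF q])
       (auto simp: kerr_h_simps kerr_O_nth kerr_O_entry_offdiag det_kerr assms(3) kerr_inverse_metric_def)
next
  show "(cmod (kerr_q a y))\<^sup>2 \<noteq> 0"
    using kerr_q_pos[OF assms(1) y assms(2)] by simp
qed (use sin_th_pos(1) in \<open>force simp: kerr_h_simps\<close>)+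

text \<open>Where the determinant vanishes, the value \<open>1\<close> is arbitrary: any positive factor would do.\<close>

definition whiting_q2 :: "real \<Rightarrow> real \<Rightarrow> real \<Rightarrow> real \<Rightarrow> real \<Rightarrow> point \<Rightarrow> real" where
  "whiting_q2 m a \<epsilon> S Rt x =
     (if whiting_disc m a \<epsilon> S Rt x = 0 then 1 else sqrt \<bar>whiting_disc m a \<epsilon> S Rt x\<bar>)"

definition whiting_inverse_metric ::
  "real \<Rightarrow> real \<Rightarrow> real \<Rightarrow> real \<Rightarrow> real \<Rightarrow> real \<Rightarrow> point \<Rightarrow> tensor" where
  "whiting_inverse_metric m a \<epsilon> S R Rt x =
     (1 / whiting_q2 m a \<epsilon> S Rt x) *\<^sub>R (whiting_h m a \<epsilon> S R Rt (x $ cr) + kerr_O a x)"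

lemma whiting_q2_pos: "whiting_q2 m a \<epsilon> S Rt x > 0"
  by (simp add: whiting_q2_def)

lemma whiting_inverse_metric_scaled:
  "whiting_q2 m a \<epsilon> S Rt x *\<^sub>R whiting_inverse_metric m a \<epsilon> S R Rt x
    = whiting_h m a \<epsilon> S R Rt (x $ cr) + kerr_O a x"
  using whiting_q2_pos[of m a \<epsilon> S Rt x] by (simp add: whiting_inverse_metric_def)

lemma transpose_whiting_inverse_metric:
  assumes "x \<in> whiting_dom"
  shows "transpose (whiting_inverse_metric m a \<epsilon> S R Rt x) = whiting_inverse_metric m a \<epsilon> S R Rt x"
proof -
  have "whiting_h m a \<epsilon> S R Rt r $ i $ j = whiting_h m a \<epsilon> S R Rt r $ j $ i" for r i j
    by (cases i; cases j; simp add: whiting_h_simps)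
  moreover have "kerr_O a x $ i $ j = kerr_O a x $ j $ i" for i j
    using sin_th_pos(2)[OF assms] by (cases i; cases j; simp add: kerr_O_nth kerr_O_entry_def)
  ultimately show ?thesis
    by (simp add: whiting_inverse_metric_def transpose_def vec_eq_iff)
qed

text \<open>Nondegeneracy at \<open>x\<close> forces \<open>whiting_disc\<close> to be nonzero
  there, hence on an open set around \<open>x\<close>. On that set the conformal factor is the
  square root, and the default value \<open>1\<close> does not enter the derivatives.\<close>

lemma whiting_wave_op_eq_split_wave:
  assumes "\<epsilon>\<^sup>2 = 1" "S \<noteq> 0" and x: "x \<in> whiting_dom"
    and det: "det (whiting_inverse_metric m a \<epsilon> S R Rt x) \<noteq> 0"
    and f: "\<And>i. pd i whiting_dom f differentiable (at x within whiting_dom)"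
  shows "whiting_q2 m a \<epsilon> S Rt x *\<^sub>R wave_op whiting_dom (whiting_inverse_metric m a \<epsilon> S R Rt) f x
    = split_wave whiting_dom (whiting_h m a \<epsilon> S R Rt) (kerr_O a) f x"
proof -
  let ?N = "whiting_disc m a \<epsilon> S Rt" and ?U = "{y. whiting_disc m a \<epsilon> S Rt y \<noteq> 0}"
  have "continuous_on UNIV ?N"
    unfolding whiting_disc_def Let_def by (intro continuous_intros) (use assms(2) in auto)
  then have U: "open ?U"
    using open_Collect_neq[OF _ continuous_on_const[of UNIV "0::real"]] by blast
  have "det (whiting_inverse_metric m a \<epsilon> S R Rt x)
      = (1 / whiting_q2 m a \<epsilon> S Rt x) ^ 4 * det (whiting_h m a \<epsilon> S R Rt (x $ cr) + kerr_O a x)"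
    by (simp only: whiting_inverse_metric_def det_scaleR_coord)
  then have "x \<in> ?U"
    using det assms(1,2) sin_th_pos(2)[OF x] by (auto simp: det_whiting)
  show ?thesis
  proof (rule wave_op_eq_split_wave[OF coord_approachable_whiting_dom x _ f whiting_h_deriv[OF assms(2)]
        _ U \<open>x \<in> ?U\<close> whiting_inverse_metric_scaled])
    fix z assume z: "z \<in> whiting_dom \<inter> ?U"
    have "(whiting_q2 m a \<epsilon> S Rt z)\<^sup>2 = \<bar>?N z\<bar>"
      using z by (simp add: whiting_q2_def)
    then show "vol_density (whiting_inverse_metric m a \<epsilon> S R Rt) z = whiting_q2 m a \<epsilon> S Rt z * sin (z $ cth)"
      using sin_th_pos(2)[of z] z assms(1,2)
      by (intro vol_density_scaled[where M = "whiting_h m a \<epsilon> S R Rt (z $ cr) + kerr_O a z",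
            OF whiting_q2_pos])
         (auto simp: whiting_h_simps kerr_O_nth kerr_O_entry_offdiag det_whiting power_divide
           whiting_inverse_metric_def)
  qed (use sin_th_pos(2) whiting_q2_pos[of m a \<epsilon> S Rt x] in \<open>force simp: whiting_h_simps\<close>)+
qed

subsection \<open>The weighted transform\<close>

lemma linear_mk_point:
  assumes "linear f" "linear g" "linear h" "linear k"
  shows "bounded_linear (\<lambda>v::point. mk_point (f v) (g v) (h v) (k v))"
proof -
  interpret f: linear f by fact
  interpret g: linear g by fact
  interpret h: linear h by fact
  interpret k: linear k by fact
  have "linear (\<lambda>v::point. mk_point (f v) (g v) (h v) (k v))"
    by (rule linearI)
       (auto simp: mk_point_def vec_eq_iff f.add f.scale g.add g.scale h.add h.scale k.add k.scale
         split: coord.split)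
  then show ?thesis
    by (simp add: linear_conv_bounded_linear)
qed

lemma mk_point_nth [simp]:
  "mk_point w r \<theta> \<phi> $ cw = w" "mk_point w r \<theta> \<phi> $ cr = r"
  "mk_point w r \<theta> \<phi> $ cth = \<theta>" "mk_point w r \<theta> \<phi> $ cph = \<phi>"
  by (simp_all add: mk_point_def)

lemma continuous_on_mk_point [continuous_intros]:
  assumes "continuous_on A f" "continuous_on A g" "continuous_on A h" "continuous_on A k"
  shows "continuous_on A (\<lambda>z. mk_point (f z) (g z) (h z) (k z))"
  unfolding mk_point_def
proof (rule continuous_on_vec_lambda)
  fix i show "continuous_on A (\<lambda>z. case i of cw \<Rightarrow> f z | cr \<Rightarrow> g z | cth \<Rightarrow> h z | cph \<Rightarrow> k z)"
    using assms by (cases i) auto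
qed

lemma smooth_upto_pd:
  assumes "smooth_upto D f"
  shows "smooth_upto D (pd i D f)"
  unfolding smooth_upto_def
proof
  fix k
  have "Ck_on (Suc k) D f"
    using assms unfolding smooth_upto_def by blast
  then show "Ck_on k D (pd i D f)"
    by simp
qed

lemma smooth_upto_Ck_on: "smooth_upto D f \<Longrightarrow> Ck_on k D f"
  by (simp add: smooth_upto_def)

lemma smooth_upto_differentiable: "smooth_upto D f \<Longrightarrow> f differentiable_on D"
  using smooth_upto_Ck_on[of D f 1] by (simp add: One_nat_def)

lemma smooth_upto_continuous: "smooth_upto D f \<Longrightarrow> continuous_on D f"
  using smooth_upto_Ck_on[of D f 0] by simp

text \<open>Convexity is what the Leibniz rule asks of the parameter domain.\<close>

lemma convex_whiting_dom: "convex whiting_dom"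
proof -
  have eq: "whiting_dom = {x. axis cth 1 \<bullet> x > 0} \<inter> {x. axis cth 1 \<bullet> x < pi}"
    by (auto simp: whiting_dom_def inner_axis')
  show ?thesis
    unfolding eq by (intro convex_Int convex_halfspace_gt convex_halfspace_lt)
qed

text \<open>\<open>c\<close> is the upper end of integration; it is later placed beyond the radial
  support of \<psi>, so that all integrals run over a compact interval.\<close>

locale whiting_transform =
  fixes m a S R Rt c :: real
  assumes c: "r_plus m a \<le> c"
begin

abbreviation "D \<equiv> kerr_dom m a"
abbreviation "W \<equiv> whiting_dom"
abbreviation "b \<equiv> r_plus m a"
abbreviation "X x \<equiv> S * ((x :: point) $ cr - Rt)"

text \<open>Affine in \<open>r\<close> for fixed \<open>x\<close>, with velocity
  \<open>mk_point (X x) 1 0 0\<close>, and affine in \<open>x\<close> for fixed \<open>r\<close>.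
  The first fact serves integration by parts, the second differentiation under the integral.\<close>

definition ray :: "point \<Rightarrow> real \<Rightarrow> point" where
  "ray x r = mk_point (x $ cw + whiting_phase S R Rt (x $ cr) r) r (x $ cth) (x $ cph)"

text \<open>Radial weights are needed because each derivative in the transformed radius brings down a
  factor \<open>S (r - R)\<close>.\<close>

definition wint :: "(real \<Rightarrow> real) \<Rightarrow> (point \<Rightarrow> complex) \<Rightarrow> point \<Rightarrow> complex" where
  "wint p F x = integral {b..c} (\<lambda>r. p r *\<^sub>R F (ray x r))"

lemma ray_in_D: "x \<in> W \<Longrightarrow> b \<le> r \<Longrightarrow> ray x r \<in> D"
  by (simp add: ray_def kerr_dom_def whiting_dom_def)

lemma ray_nth [simp]: "ray x r $ cr = r" "ray x r $ cth = x $ cth"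
  by (simp_all add: ray_def)

lemma continuous_on_ray:
  "continuous_on A (\<lambda>z. ray (fst z) (snd z))"
  unfolding ray_def whiting_phase_def by (intro continuous_intros)

lemma continuous_on_F_ray:
  assumes "continuous_on D F"
  shows "continuous_on (W \<times> {b..c}) (\<lambda>z. F (ray (fst z) (snd z)))"
  by (rule continuous_on_compose2[OF assms continuous_on_ray]) (auto simp: ray_in_D)

lemma continuous_on_F_ray_snd:
  assumes "continuous_on D F" "x \<in> W"
  shows "continuous_on {b..c} (\<lambda>r. F (ray x r))"
proof -
  have "continuous_on {b..c} (\<lambda>r. (x, r))"
    by (rule continuous_on_Pair[OF continuous_on_const continuous_on_id])
  from continuous_on_compose2[OF continuous_on_F_ray[OF assms(1)] this] assms(2) show ?thesis
    by auto
qed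

lemma wint_integrable:
  fixes F :: "point \<Rightarrow> complex"
  assumes "continuous_on D F" "continuous_on UNIV p" "x \<in> W"
  shows "(\<lambda>r. p r *\<^sub>R F (ray x r)) integrable_on {b..c}"
proof (rule integrable_continuous_real)
  show "continuous_on {b..c} (\<lambda>r. p r *\<^sub>R F (ray x r))"
    using continuous_on_subset[OF assms(2)] continuous_on_F_ray_snd[OF assms(1,3)]
    by (intro continuous_on_scaleR) auto
qed

lemma wint_has_integral:
  assumes "continuous_on D F" "continuous_on UNIV p" "x \<in> W"
  shows "((\<lambda>r. p r *\<^sub>R F (ray x r)) has_integral wint p F x) {b..c}"
  unfolding wint_def by (rule integrable_integral[OF wint_integrable[OF assms]])

lemma has_derivative_ray:
  "((\<lambda>x. ray x r) has_derivative
     (\<lambda>v. mk_point (v $ cw + S * (r - R) * v $ cr) 0 (v $ cth) (v $ cph))) (at x within A)"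
proof -
  let ?L = "\<lambda>v::point. mk_point (v $ cw + S * (r - R) * v $ cr) 0 (v $ cth) (v $ cph)"
  have "bounded_linear ?L"
    by (rule linear_mk_point) (auto intro!: linearI simp: algebra_simps)
  then have "((\<lambda>x. ?L x + mk_point (- S * (r - R) * Rt) r 0 0) has_derivative (\<lambda>v. ?L v + 0)) (at x within A)"
    by (intro has_derivative_add has_derivative_const bounded_linear_imp_has_derivative)
  moreover have "ray x r = ?L x + mk_point (- S * (r - R) * Rt) r 0 0" for x
    by (auto simp: vec_eq_iff ray_def mk_point_def whiting_phase_def algebra_simps split: coord.split)
  ultimately show ?thesis
    by simp
qed

text \<open>For fixed \<open>r\<close>, moving the transformed radius shifts only the
  \<open>w\<close> coordinate of the ray. Hence \<open>pd cr\<close> of \<open>F\<close> does not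
  occur and the direction \<open>cr\<close> contributes a multiple of \<open>pd cw\<close>.\<close>

lemma has_derivative_F_ray:
  assumes F: "F differentiable_on D" and x: "x \<in> W" and r: "b \<le> r"
  shows "((\<lambda>x. F (ray x r)) has_derivative
     (\<lambda>v. v $ cw *\<^sub>R pd cw D F (ray x r) + (v $ cr * (S * (r - R))) *\<^sub>R pd cw D F (ray x r)
        + v $ cth *\<^sub>R pd cth D F (ray x r) + v $ cph *\<^sub>R pd cph D F (ray x r))) (at x within W)"
proof -
  have "((\<lambda>x. F (ray x r)) has_derivative
     (\<lambda>v. \<Sum>i\<in>UNIV. mk_point (v $ cw + S * (r - R) * v $ cr) 0 (v $ cth) (v $ cph) $ i
        *\<^sub>R pd i D F (ray x r))) (at x within W)"
    by (rule has_derivative_in_compose2[where t = D and g' = "\<lambda>z v. \<Sum>i\<in>UNIV. v $ i *\<^sub>R pd i D F z",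
          OF has_derivative_pd _ x has_derivative_ray])
       (use F r in \<open>auto simp: ray_in_D differentiable_on_def\<close>)
  then show ?thesis
    by (simp add: sum_coord algebra_simps)
qed

lemma wint_has_derivative:
  assumes F: "Ck_on 1 D F" and p: "continuous_on UNIV p" and x: "x \<in> W"
  shows "(wint p F has_derivative
     (\<lambda>v. v $ cw *\<^sub>R wint p (pd cw D F) x + v $ cr *\<^sub>R wint (\<lambda>r. S * (r - R) * p r) (pd cw D F) x
        + v $ cth *\<^sub>R wint p (pd cth D F) x + v $ cph *\<^sub>R wint p (pd cph D F) x)) (at x within W)"
proof -
  have dF: "F differentiable_on D" and cF: "\<And>i. continuous_on D (pd i D F)"
    using F by (auto simp: One_nat_def)
  \<comment> \<open>The Leibniz rule needs the derivative as a continuous family of bounded linear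
    maps. Each partial becomes a rank-one map; \<open>q'\<close> is the contribution of the
    direction \<open>cr\<close>.\<close>
  define e :: "coord \<Rightarrow> point \<Rightarrow>\<^sub>L real" where "e i = blinfun_inner_left (axis i 1)" for i
  have e: "blinfun_apply (e i) v = v $ i" for i v
    by (simp add: e_def inner_axis)
  define q where "q i x t = blinfun_scaleR_left (p t *\<^sub>R pd i D F (ray x t)) o\<^sub>L e i" for i x t
  define q' where "q' x t = blinfun_scaleR_left ((S * (t - R) * p t) *\<^sub>R pd cw D F (ray x t)) o\<^sub>L e cr" for x t
  let ?f' = "\<lambda>x t. q cw x t + q' x t + q cth x t + q cph x t"
  have cp: "continuous_on (W \<times> {b..c}) (\<lambda>z. p (snd z))"
    by (rule continuous_on_compose2[OF p]) (auto intro: continuous_intros)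
  have cf': "continuous_on (W \<times> {b..c}) (\<lambda>(x, t). ?f' x t)"
    unfolding q_def q'_def case_prod_beta
    by (intro continuous_intros bounded_linear.continuous_on[OF bounded_linear_blinfun_scaleR_left]
        cp continuous_on_F_ray cF)
  have leibniz: "((\<lambda>x. integral (cbox b c) (\<lambda>t. p t *\<^sub>R F (ray x t))) has_derivative
      integral (cbox b c) (?f' x)) (at x within W)"
  proof (rule leibniz_rule[OF _ _ _ x])
    fix y t assume y: "y \<in> W" and t: "t \<in> cbox b c"
    show "((\<lambda>x. p t *\<^sub>R F (ray x t)) has_derivative blinfun_apply (?f' y t)) (at y within W)"
      by (rule has_derivative_eq_rhs[OF has_derivative_scaleR_right[OF has_derivative_F_ray[OF dF y]]])
         (use t in \<open>auto simp: blinfun.add_left q_def q'_def e fun_eq_iff scaleR_add_right mult_ac\<close>)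
  next
    fix y assume y: "y \<in> W"
    show "(\<lambda>t. p t *\<^sub>R F (ray y t)) integrable_on cbox b c"
      using wint_integrable[OF differentiable_imp_continuous_on[OF dF] p y] by simp
  next
    show "continuous_on (W \<times> cbox b c) (\<lambda>(x, t). ?f' x t)"
      using cf' by simp
    show "convex W"
      by (rule convex_whiting_dom)
  qed
  \<comment> \<open>Evaluation at \<open>v\<close> is continuous and linear, so it passes through
    the integral of maps.\<close>
  have apply_eq: "blinfun_apply (integral (cbox b c) (?f' x)) v
     = v $ cw *\<^sub>R wint p (pd cw D F) x + v $ cr *\<^sub>R wint (\<lambda>r. S * (r - R) * p r) (pd cw D F) x
        + v $ cth *\<^sub>R wint p (pd cth D F) x + v $ cph *\<^sub>R wint p (pd cph D F) x" for v
  proof -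
    have "continuous_on {b..c} (?f' x)"
      using continuous_on_compose2[OF cf' continuous_on_Pair[OF continuous_on_const continuous_on_id],
          of x "{b..c}"] x
      by auto
    then have "blinfun_apply (integral (cbox b c) (?f' x)) v = integral {b..c} (\<lambda>t. blinfun_apply (?f' x t) v)"
      by (simp add: blinfun_apply_integral integrable_continuous_real)
    also have "\<dots> = v $ cw *\<^sub>R wint p (pd cw D F) x + v $ cr *\<^sub>R wint (\<lambda>r. S * (r - R) * p r) (pd cw D F) x
        + v $ cth *\<^sub>R wint p (pd cth D F) x + v $ cph *\<^sub>R wint p (pd cph D F) x"
      unfolding q_def q'_def blinfun.add_left blinfun_apply_blinfun_compose e blinfun_scaleR_left.rep_eq
      by (intro integral_unique has_integral_add has_integral_cmul wint_has_integral cF p x continuous_intros)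
    finally show ?thesis .
  qed
  show ?thesis
    using has_derivative_eq_rhs[OF leibniz ext[OF apply_eq]] by (simp add: wint_def[abs_def])
qed

text \<open>Weighted transforms of smooth functions are closed under all derivatives in
  \<open>W\<close>, so second derivatives follow by iteration.\<close>

lemma
  assumes F: "Ck_on 1 D F" and p: "continuous_on UNIV p" and x: "x \<in> W"
  shows wint_differentiable: "wint p F differentiable (at x within W)"
    and pd_wint: "i \<noteq> cr \<Longrightarrow> pd i W (wint p F) x = wint p (pd i D F) x"
    and pd_cr_wint: "pd cr W (wint p F) x = wint (\<lambda>r. S * (r - R) * p r) (pd cw D F) x"
  using pd_eq[OF coord_approachable_whiting_dom x wint_has_derivative[OF assms]]
    wint_has_derivative[OF assms]
  by (auto simp: differentiable_def axis_def intro: coord.exhaust[of i])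

text \<open>The fundamental theorem of calculus for \<open>p r *\<^sub>R F (ray x r)\<close>: the
  end \<open>c\<close> drops out by \<open>F0\<close>, and the end \<open>b\<close> leaves the
  horizon value.\<close>

lemma wint_pd_cr:
  assumes F: "Ck_on 1 D F" and p: "\<And>r. (p has_real_derivative p' r) (at r)" and p': "continuous_on UNIV p'"
    and x: "x \<in> W" and F0: "F (ray x c) = 0"
  shows "wint p (pd cr D F) x = - (p b *\<^sub>R F (ray x b)) - wint p' F x - X x *\<^sub>R wint p (pd cw D F) x"
proof -
  have dF: "F differentiable_on D" and cF: "\<And>i. continuous_on D (pd i D F)"
    using F by (auto simp: One_nat_def)
  have cp: "continuous_on UNIV p"
    using p by (meson DERIV_isCont continuous_at_imp_continuous_on)
  \<comment> \<open>\<open>z\<close> is only the base point of the affine line and may lie outside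
    \<open>D\<close>.\<close>
  define z where "z = ray x 0"
  have ray: "ray x r = z + r *\<^sub>R mk_point (X x) 1 0 0" for r
    by (auto simp: z_def vec_eq_iff ray_def mk_point_def whiting_phase_def algebra_simps split: coord.split)
  have deriv: "((\<lambda>r. F (ray x r)) has_vector_derivative X x *\<^sub>R pd cw D F (ray x r) + pd cr D F (ray x r))
      (at r within {b..c})" if r: "r \<in> {b..c}" for r
  proof -
    have "((\<lambda>r. ray x r) has_derivative (\<lambda>t. 0 + t *\<^sub>R mk_point (X x) 1 0 0)) (at r within {b..c})"
      unfolding ray by (intro derivative_intros)
    moreover have "(F has_derivative (\<lambda>v. \<Sum>i\<in>UNIV. v $ i *\<^sub>R pd i D F z)) (at z within D)"
      if "z \<in> D" for z
      using dF that by (simp add: has_derivative_pd differentiable_on_def)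
    moreover have "ray x ` {b..c} \<subseteq> D"
      using x by (auto simp: ray_in_D)
    ultimately have "((\<lambda>r. F (ray x r)) has_derivative
        (\<lambda>t. \<Sum>i\<in>UNIV. (0 + t *\<^sub>R mk_point (X x) 1 0 0) $ i *\<^sub>R pd i D F (ray x r))) (at r within {b..c})"
      using r by (intro has_derivative_in_compose2[where g = F and f = "ray x" and x = r and s = "{b..c}" and t = D
            and f' = "\<lambda>t. 0 + t *\<^sub>R mk_point (X x) 1 0 0"
            and g' = "\<lambda>z v. \<Sum>i\<in>UNIV. v $ i *\<^sub>R pd i D F z"])
    then show ?thesis
      by (simp add: has_vector_derivative_def sum_coord scaleR_add_right)
  qed
  have "((\<lambda>r. p r *\<^sub>R F (ray x r)) has_vector_derivative
      p r *\<^sub>R (X x *\<^sub>R pd cw D F (ray x r) + pd cr D F (ray x r)) + p' r *\<^sub>R F (ray x r))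
      (at r within {b..c})" if "r \<in> {b..c}" for r
    by (rule has_vector_derivative_scaleR[OF has_field_derivative_at_within[OF p] deriv[OF that]])
  then have "((\<lambda>r. p r *\<^sub>R (X x *\<^sub>R pd cw D F (ray x r) + pd cr D F (ray x r)) + p' r *\<^sub>R F (ray x r))
      has_integral p c *\<^sub>R F (ray x c) - p b *\<^sub>R F (ray x b)) {b..c}"
    by (rule fundamental_theorem_of_calculus[OF c])
  moreover have "((\<lambda>r. X x *\<^sub>R (p r *\<^sub>R pd cw D F (ray x r)) + p r *\<^sub>R pd cr D F (ray x r) + p' r *\<^sub>R F (ray x r))
      has_integral X x *\<^sub>R wint p (pd cw D F) x + wint p (pd cr D F) x + wint p' F x) {b..c}"
    by (intro has_integral_add has_integral_cmul wint_has_integral cF cp p' x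
        differentiable_imp_continuous_on[OF dF])
  ultimately have "X x *\<^sub>R wint p (pd cw D F) x + wint p (pd cr D F) x + wint p' F x
      = p c *\<^sub>R F (ray x c) - p b *\<^sub>R F (ray x b)"
    by (intro has_integral_unique) (simp add: scaleR_add_right mult_ac)+
  then show ?thesis
    by (simp add: F0 algebra_simps)
qed

text \<open>Differentiating \<open>wint_pd_cr\<close> instead of commuting \<open>\<partial>\<^sub>i\<close> with \<open>\<partial>\<^sub>r\<close> avoids the symmetry of
  second derivatives.\<close>

lemma wint_pd_pd_cr:
  assumes F: "Ck_on 1 D F" and F': "\<And>j. Ck_on 1 D (pd j D F)"
    and p: "\<And>r. (p has_real_derivative p' r) (at r)" and p': "continuous_on UNIV p'"
    and x: "x \<in> W" and F0: "\<And>y. y \<in> W \<Longrightarrow> F (ray y c) = 0" and i: "i \<in> {cw, cph}"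
  shows "wint p (pd i D (pd cr D F)) x
    = - (p b *\<^sub>R pd i D F (ray x b)) - wint p' (pd i D F) x - X x *\<^sub>R wint p (pd i D (pd cw D F)) x"
proof -
  note W = coord_approachable_whiting_dom x
  have cp: "continuous_on UNIV p"
    using p by (meson DERIV_isCont continuous_at_imp_continuous_on)
  have dF: "F differentiable_on D"
    using F by (auto simp: One_nat_def)
  have "wint p (pd i D (pd cr D F)) x = pd i W (wint p (pd cr D F)) x"
    using pd_wint[OF F' cp x] i by force
  also have "\<dots> = pd i W (\<lambda>y. - (p b *\<^sub>R F (ray y b)) - wint p' F y - X y *\<^sub>R wint p (pd cw D F) y) x"
    by (rule pd_cong[OF x]) (rule wint_pd_cr[OF F p p' _ F0])
  also have "\<dots> = - (p b *\<^sub>R pd i D F (ray x b)) - wint p' (pd i D F) x - X x *\<^sub>R wint p (pd i D (pd cw D F)) x"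
  proof -
    \<comment> \<open>The factor \<open>X\<close> varies with the transformed radius only, so its
      derivative vanishes in the directions \<open>cw\<close> and \<open>cph\<close>.\<close>
    have "((\<lambda>y. S * (y $ cr - Rt)) has_derivative (\<lambda>v. S * v $ cr)) (at x within W)"
      by (rule has_derivative_coord_comp[where u = "\<lambda>r. S * (r - Rt)"])
         (auto intro!: derivative_eq_intros)
    note has_derivative_diff[OF has_derivative_diff[OF
        has_derivative_minus[OF has_derivative_scaleR_right[OF has_derivative_F_ray[OF dF x order_refl]]]
        wint_has_derivative[OF F p' x]]
        has_derivative_scaleR[OF this wint_has_derivative[OF F' cp x]]]
    from pd_eq[OF W this] i show ?thesis
      by (auto simp: axis_def)
  qed
  finally show ?thesis .
qed

text \<open>All radial weights in play have degree at most two, so three moments form a common basis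
  for comparing both sides.\<close>

lemma wint_poly:
  assumes "continuous_on D F" "x \<in> W" "\<And>r. p r = k0 + k1 * r + k2 * r\<^sup>2"
  shows "wint p F x
    = k0 *\<^sub>R wint (\<lambda>r. 1) F x + k1 *\<^sub>R wint (\<lambda>r. r) F x + k2 *\<^sub>R wint (\<lambda>r. r\<^sup>2) F x"
proof -
  have "((\<lambda>r. k0 *\<^sub>R (1 *\<^sub>R F (ray x r)) + k1 *\<^sub>R (r *\<^sub>R F (ray x r)) + k2 *\<^sub>R (r\<^sup>2 *\<^sub>R F (ray x r))) has_integral
     k0 *\<^sub>R wint (\<lambda>r. 1) F x + k1 *\<^sub>R wint (\<lambda>r. r) F x + k2 *\<^sub>R wint (\<lambda>r. r\<^sup>2) F x) {b..c}"
    by (intro has_integral_add has_integral_cmul wint_has_integral assms continuous_intros)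
  then show ?thesis
    by (simp add: wint_def integral_unique scaleR_add_left assms(3))
qed

subsection \<open>The two sides in terms of radial moments\<close>

text \<open>The right-hand side. Each derivative in the transformed radius brings the weight
  \<open>S * (r - R)\<close>, and the powers of \<open>S\<close> cancel those in
  \<open>whiting_h\<close>. The combinations of \<open>I1\<close> and \<open>I2\<close> with
  \<open>R\<close> are moments about \<open>R\<close>.\<close>

lemma split_wave_whiting:
  fixes \<psi> :: "point \<Rightarrow> complex"
  assumes S: "S \<noteq> 0" and \<psi>: "smooth_upto D \<psi>" and x: "x \<in> W"
  defines "X0 \<equiv> X x" and "I \<equiv> \<lambda>i j. wint (\<lambda>r. 1) (pd i D (pd j D \<psi>)) x"
    and "J \<equiv> \<lambda>i. wint (\<lambda>r. 1) (pd i D \<psi>) x"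
    and "I1 \<equiv> wint (\<lambda>r. r) (pd cw D (pd cw D \<psi>)) x" and "I2 \<equiv> wint (\<lambda>r. r\<^sup>2) (pd cw D (pd cw D \<psi>)) x"
    and "J1 \<equiv> wint (\<lambda>r. r) (pd cw D \<psi>) x"
  shows "split_wave W (whiting_h m a \<epsilon> S R Rt) (kerr_O a) (wint (\<lambda>r. 1) \<psi>) x =
      (kerr_Delta m a R * X0\<^sup>2 - 2 * \<epsilon> * (R\<^sup>2 + a\<^sup>2) * X0) *\<^sub>R I cw cw
      + (2 * ((R - m) * X0\<^sup>2 - 2 * \<epsilon> * R * X0)) *\<^sub>R (I1 - R *\<^sub>R I cw cw)
      + (X0 * (X0 - 2 * \<epsilon>)) *\<^sub>R (I2 - (2 * R) *\<^sub>R I1 + R\<^sup>2 *\<^sub>R I cw cw)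
      - (\<epsilon> * a * X0) *\<^sub>R (I cw cph + I cph cw)
      + (2 * (R - m) * X0 - 2 * \<epsilon> * R) *\<^sub>R J cw + (2 * (X0 - \<epsilon>)) *\<^sub>R (J1 - R *\<^sub>R J cw)
      + (I cth cth + (cos (x $ cth) / sin (x $ cth)) *\<^sub>R J cth + (a\<^sup>2 * (sin (x $ cth))\<^sup>2) *\<^sub>R I cw cw
        + a *\<^sub>R I cw cph + a *\<^sub>R I cph cw + (1 / (sin (x $ cth))\<^sup>2) *\<^sub>R I cph cph)"
proof -
  let ?g = "wint (\<lambda>r. 1) \<psi>" and ?q = "\<lambda>r. S * (r - R) * 1"
  note \<psi>1 = smooth_upto_pd[OF \<psi>] and c1 = smooth_upto_Ck_on[of _ _ 1]
  note \<psi>2 = smooth_upto_pd[OF \<psi>1]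
  have q: "continuous_on UNIV ?q"
    by (intro continuous_intros)
  have one: "continuous_on UNIV (\<lambda>r. 1 :: real)"
    by (rule continuous_on_const)
  have g: "pd i W ?g y = wint (\<lambda>r. 1) (pd i D \<psi>) y" if "y \<in> W" "i \<noteq> cr" for i y
    using pd_wint[OF c1[OF \<psi>] one that] .
  have gr: "pd cr W ?g y = wint ?q (pd cw D \<psi>) y" if "y \<in> W" for y
    using pd_cr_wint[OF c1[OF \<psi>] one that] .
  have gg: "pd i W (pd j W ?g) x = I i j" if "i \<noteq> cr" "j \<noteq> cr" for i j
    using pd_cong[OF x g[OF _ that(2)]] pd_wint[OF c1[OF \<psi>1] one x that(1)] by (simp add: I_def)
  define Y where "Y = (\<lambda>i j. wint ?q (pd i D (pd j D \<psi>)) x)"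
  \<comment> \<open>In \<open>cw\<close> and \<open>cr\<close> both orders of the mixed derivative
    lead to the same \<open>Y cw cw\<close>.\<close>
  have grg: "pd cr W (pd j W ?g) x = Y cw j" if "j \<noteq> cr" for j
    using pd_cong[OF x g[OF _ that]] pd_cr_wint[OF c1[OF \<psi>1] one x] by (simp add: Y_def)
  have ggr: "pd i W (pd cr W ?g) x = Y i cw" if "i \<noteq> cr" for i
    using pd_cong[OF x gr] pd_wint[OF c1[OF \<psi>1] q x that] by (simp add: Y_def)
  have diff: "pd i W ?g differentiable (at x within W)" for i
  proof -
    \<comment> \<open>Every first derivative of the transform is again a weighted transform, with
      weight \<open>1\<close> or \<open>?q\<close>, and therefore differentiable.\<close>
    obtain p F where pF: "continuous_on UNIV p" "Ck_on 1 D F" "\<And>y. y \<in> W \<Longrightarrow> pd i W ?g y = wint p F y"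
    proof (cases "i = cr")
      case True
      then show thesis
        using that[OF q c1[OF \<psi>1]] gr by blast
    next
      case False
      then show thesis
        using that[OF one c1[OF \<psi>1]] g by blast
    qed
    have "wint p F differentiable (at x within W)"
      by (rule wint_differentiable[OF pF(2,1) x])
    then show ?thesis
      unfolding differentiable_def by (blast intro: has_derivative_transform[OF x] pF(3))
  qed
  note wp = wint_poly[OF smooth_upto_continuous[OF \<psi>2] x] wint_poly[OF smooth_upto_continuous[OF \<psi>1] x]
  have q_ww: "Y cw cw = S *\<^sub>R (I1 - R *\<^sub>R I cw cw)"
    unfolding Y_def
    by (subst wp(1)[where ?k0.0 = "- S * R" and ?k1.0 = S and ?k2.0 = 0])
       (simp_all add: I_def I1_def algebra_simps)
  have q_w: "wint ?q (pd cw D \<psi>) x = S *\<^sub>R (J1 - R *\<^sub>R J cw)"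
    by (subst wp(2)[where ?k0.0 = "- S * R" and ?k1.0 = S and ?k2.0 = 0])
       (simp_all add: J_def J1_def algebra_simps)
  have qq_ww: "wint (\<lambda>r. S * (r - R) * ?q r) (pd cw D (pd cw D \<psi>)) x
      = S\<^sup>2 *\<^sub>R (I2 - (2 * R) *\<^sub>R I1 + R\<^sup>2 *\<^sub>R I cw cw)"
    by (subst wp(1)[where ?k0.0 = "S\<^sup>2 * R\<^sup>2" and ?k1.0 = "- 2 * S\<^sup>2 * R" and ?k2.0 = "S\<^sup>2"])
       (simp_all add: I_def I1_def I2_def algebra_simps power2_eq_square)
  have grgr: "pd cr W (pd cr W ?g) x = S\<^sup>2 *\<^sub>R (I2 - (2 * R) *\<^sub>R I1 + R\<^sup>2 *\<^sub>R I cw cw)"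
    using pd_cong[OF x gr] pd_cr_wint[OF c1[OF \<psi>1] q x] qq_ww by simp
  have J: "pd i W ?g x = J i" if "i \<noteq> cr" for i
    using g[OF x that] by (simp add: J_def)
  have Jr: "pd cr W ?g x = S *\<^sub>R (J1 - R *\<^sub>R J cw)"
    using gr[OF x] q_w by simp
  \<comment> \<open>Cancelling the powers of \<open>S\<close> at this stage leaves an identity
    without division by \<open>S\<close>.\<close>
  have h_wr: "(1 / S * y) *\<^sub>R (S *\<^sub>R v) = y *\<^sub>R v" "(y / S) *\<^sub>R (S *\<^sub>R v) = y *\<^sub>R v"
    "(1 / S\<^sup>2 * y) *\<^sub>R (S\<^sup>2 *\<^sub>R v) = y *\<^sub>R v" for y and v :: complex
    using S by simp_all
  show ?thesis
    by (subst split_wave_expand[OF coord_approachable_whiting_dom x _ diff whiting_h_deriv[OF S]])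
       (use sin_th_pos(2) in force,
        simp add: sum_coord whiting_h_simps whiting_h_deriv_def Let_def gg grg ggr grgr q_ww J Jr h_wr
          scaleR_add_right scaleR_diff_right flip: X0_def del: scaleR_scaleR times_divide_eq_left,
        simp add: scaleR_conv_of_real algebra_simps power2_eq_square)
qed

text \<open>The left-hand side. Integration by parts removes every radial derivative of \<psi>,
  leaving moments and horizon values of first derivatives.\<close>

lemma wint_kerr_wave:
  fixes \<psi> :: "point \<Rightarrow> complex"
  assumes a: "\<bar>a\<bar> < m" and \<psi>: "smooth_upto D \<psi>" and x: "x \<in> W"
    and van: "\<forall>y\<in>D. y $ cr > M \<longrightarrow> \<psi> y = 0" and M: "M < c"
  defines "X0 \<equiv> X x" and "I \<equiv> \<lambda>i j. wint (\<lambda>r. 1) (pd i D (pd j D \<psi>)) x"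
    and "J \<equiv> \<lambda>i. wint (\<lambda>r. 1) (pd i D \<psi>) x"
    and "I1 \<equiv> wint (\<lambda>r. r) (pd cw D (pd cw D \<psi>)) x" and "I2 \<equiv> wint (\<lambda>r. r\<^sup>2) (pd cw D (pd cw D \<psi>)) x"
    and "J1 \<equiv> wint (\<lambda>r. r) (pd cw D \<psi>) x"
  shows "((\<lambda>r. split_wave D (kerr_h m a \<epsilon>) (kerr_O a) \<psi> (ray x r)) has_integral
      X0\<^sup>2 *\<^sub>R (I2 - (2 * m) *\<^sub>R I1 + a\<^sup>2 *\<^sub>R I cw cw) - (2 * \<epsilon> * X0) *\<^sub>R (I2 + a\<^sup>2 *\<^sub>R I cw cw)
      + (2 * X0) *\<^sub>R (J1 - m *\<^sub>R J cw) - (2 * \<epsilon>) *\<^sub>R J1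
      - (\<epsilon> * a * X0) *\<^sub>R (I cw cph + I cph cw)
      - (2 * \<epsilon> * (b\<^sup>2 + a\<^sup>2)) *\<^sub>R pd cw D \<psi> (ray x b) - (2 * \<epsilon> * a) *\<^sub>R pd cph D \<psi> (ray x b)
      + (I cth cth + (cos (x $ cth) / sin (x $ cth)) *\<^sub>R J cth + (a\<^sup>2 * (sin (x $ cth))\<^sup>2) *\<^sub>R I cw cw
        + a *\<^sub>R I cw cph + a *\<^sub>R I cph cw + (1 / (sin (x $ cth))\<^sup>2) *\<^sub>R I cph cph)) {b..c}"
proof -
  let ?d = "\<lambda>i. pd i D \<psi>" and ?dd = "\<lambda>i j. pd i D (pd j D \<psi>)"
  let ?\<Delta> = "kerr_Delta m a" and ?\<Delta>' = "\<lambda>r. 2 * (r - m)"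
  let ?A = "\<lambda>r. \<epsilon> * (r\<^sup>2 + a\<^sup>2)" and ?A' = "\<lambda>r. 2 * \<epsilon> * r"
  note \<psi>1 = smooth_upto_pd[OF \<psi>] and c1 = smooth_upto_Ck_on[of _ _ 1]
  note \<psi>2 = smooth_upto_pd[OF \<psi>1]
  note cont = smooth_upto_continuous[OF \<psi>1] smooth_upto_continuous[OF \<psi>2]
  have D\<Delta>: "(?\<Delta> has_real_derivative ?\<Delta>' r) (at r)" and DA: "(?A has_real_derivative ?A' r) (at r)" for r
    unfolding kerr_Delta_def[abs_def] by (auto intro!: derivative_eq_intros)
  have Dk: "((\<lambda>r. \<epsilon> * a) has_real_derivative 0) (at r)" for r :: real
    by (rule DERIV_const)
  have cp: "continuous_on UNIV ?\<Delta>'" "continuous_on UNIV ?A'" "continuous_on UNIV ?\<Delta>" "continuous_on UNIV ?A"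
    by (auto simp: kerr_Delta_def[abs_def] intro!: continuous_intros)
  have c0: "continuous_on UNIV (\<lambda>r. k)" for k :: real
    by (rule continuous_on_const)
  have \<psi>0: "\<psi> (ray y c) = 0" if "y \<in> W" for y
    using van ray_in_D[OF that c] M by simp
  \<comment> \<open>Since \<open>M < c\<close>, the end of the ray has a neighbourhood on which
    \<psi> vanishes, so its derivatives vanish there too.\<close>
  have d0: "?d i (ray x c) = 0" for i
    using ray_in_D[OF x c] M van
    by (intro pd_vanish[OF coord_approachable_kerr_dom _, of _ _ _ "{y. M < y $ cr}"])
       (auto intro!: open_Collect_less continuous_intros)
  \<comment> \<open>\<open>ibp1\<close> treats an outer radial derivative, \<open>ibp2\<close> an
    inner one.\<close>
  note ibp1 = wint_pd_cr[OF c1[OF \<psi>1] _ _ x d0]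
  note ibp2 = wint_pd_pd_cr[OF c1[OF \<psi>] c1[OF \<psi>1] _ _ x \<psi>0]
  have \<Delta>b: "?\<Delta> b = 0"
    using a by (rule kerr_Delta_r_plus)
  have k0: "wint (\<lambda>r. 0) F x = 0" for F
    by (simp add: wint_def)
  note wp = wint_poly[OF cont(2) x] wint_poly[OF cont(1) x]
  have m\<Delta>: "wint ?\<Delta> (?dd cw cw) x = I2 - (2 * m) *\<^sub>R I1 + a\<^sup>2 *\<^sub>R I cw cw"
    by (subst wp(1)[where ?k0.0 = "a\<^sup>2" and ?k1.0 = "- 2 * m" and ?k2.0 = 1])
       (simp_all add: I_def I1_def I2_def kerr_Delta_def)
  have mA: "wint ?A (?dd cw cw) x = \<epsilon> *\<^sub>R (I2 + a\<^sup>2 *\<^sub>R I cw cw)"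
    by (subst wp(1)[where ?k0.0 = "\<epsilon> * a\<^sup>2" and ?k1.0 = 0 and ?k2.0 = \<epsilon>])
       (simp_all add: I_def I1_def I2_def algebra_simps)
  have m\<Delta>': "wint ?\<Delta>' (?d cw) x = 2 *\<^sub>R (J1 - m *\<^sub>R J cw)"
    by (subst wp(2)[where ?k0.0 = "- 2 * m" and ?k1.0 = 2 and ?k2.0 = 0])
       (simp_all add: J_def J1_def algebra_simps)
  have mA': "wint ?A' (?d cw) x = (2 * \<epsilon>) *\<^sub>R J1"
    by (subst wp(2)[where ?k0.0 = 0 and ?k1.0 = "2 * \<epsilon>" and ?k2.0 = 0])
       (simp_all add: J_def J1_def algebra_simps)
  have mk: "wint (\<lambda>r. k) (?dd i j) x = k *\<^sub>R I i j" for k i j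
    by (subst wp(1)[where ?k0.0 = k and ?k1.0 = 0 and ?k2.0 = 0]) (simp_all add: I_def)
  have mkJ: "wint (\<lambda>r. k) (?d i) x = k *\<^sub>R J i" for k i
    by (subst wp(2)[where ?k0.0 = k and ?k1.0 = 0 and ?k2.0 = 0]) (simp_all add: J_def)
  \<comment> \<open>Two integrations by parts, both without horizon value since
    \<open>?\<Delta> b = 0\<close>. The remainder with \<open>?\<Delta>'\<close> and
    \<open>pd cr\<close> cancels the first-order term of the operator, so no trace of \<psi> itself
    appears.\<close>
  have rr: "wint ?\<Delta> (?dd cr cr) x = - wint ?\<Delta>' (?d cr) x
      + X0 *\<^sub>R (2 *\<^sub>R (J1 - m *\<^sub>R J cw)) + X0\<^sup>2 *\<^sub>R (I2 - (2 * m) *\<^sub>R I1 + a\<^sup>2 *\<^sub>R I cw cw)"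
  proof -
    have "wint ?\<Delta> (?dd cr cr) x = - wint ?\<Delta>' (?d cr) x - X0 *\<^sub>R wint ?\<Delta> (?dd cw cr) x"
      using ibp1[OF D\<Delta> cp(1), of cr] by (simp add: \<Delta>b X0_def)
    also have "wint ?\<Delta> (?dd cw cr) x = - wint ?\<Delta>' (?d cw) x - X0 *\<^sub>R wint ?\<Delta> (?dd cw cw) x"
      using ibp2[OF D\<Delta> cp(1), of cw] by (simp add: \<Delta>b X0_def)
    finally show ?thesis
      unfolding m\<Delta> m\<Delta>' by (simp add: scaleR_diff_right power2_eq_square)
  qed
  \<comment> \<open>This term and \<open>wr\<close> each give one copy of the horizon value, which
    explains the factor 2 in \<open>horizon_term\<close>; the same holds for \<open>rp\<close> and
    \<open>pr\<close>.\<close>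
  have rw: "wint ?A (?dd cr cw) x = - (\<epsilon> * (b\<^sup>2 + a\<^sup>2)) *\<^sub>R ?d cw (ray x b) - (2 * \<epsilon>) *\<^sub>R J1
      - (X0 * \<epsilon>) *\<^sub>R (I2 + a\<^sup>2 *\<^sub>R I cw cw)"
    using ibp1[OF DA cp(2), of cw] by (simp only: mA mA' X0_def scaleR_scaleR scaleR_minus_left)
  have wr: "wint ?A (?dd cw cr) x = - (\<epsilon> * (b\<^sup>2 + a\<^sup>2)) *\<^sub>R ?d cw (ray x b) - (2 * \<epsilon>) *\<^sub>R J1
      - (X0 * \<epsilon>) *\<^sub>R (I2 + a\<^sup>2 *\<^sub>R I cw cw)"
    using ibp2[OF DA cp(2), of cw] by (simp add: mA mA' X0_def)
  have rp: "wint (\<lambda>r. \<epsilon> * a) (?dd cr cph) x = - (\<epsilon> * a) *\<^sub>R ?d cph (ray x b) - (\<epsilon> * a * X0) *\<^sub>R I cw cph"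
    using ibp1[OF Dk c0, of cph] by (simp add: mk k0 X0_def mult_ac)
  have pr: "wint (\<lambda>r. \<epsilon> * a) (?dd cph cr) x = - (\<epsilon> * a) *\<^sub>R ?d cph (ray x b) - (\<epsilon> * a * X0) *\<^sub>R I cph cw"
    using ibp2[OF Dk c0, of cph] by (simp add: mk k0 X0_def mult_ac)
  let ?s = "sin (x $ cth)" and ?co = "cos (x $ cth)"
  \<comment> \<open>Each summand has the shape weight times function on the ray, with the weight
    \<open>1\<close> kept visible, so that integrals match term by term with
    \<open>?V\<close>.\<close>
  let ?E = "\<lambda>r. ?\<Delta> r *\<^sub>R ?dd cr cr (ray x r) + ?\<Delta>' r *\<^sub>R ?d cr (ray x r)
      + ?A r *\<^sub>R ?dd cr cw (ray x r) + ?A r *\<^sub>R ?dd cw cr (ray x r) + ?A' r *\<^sub>R ?d cw (ray x r)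
      + (\<epsilon> * a) *\<^sub>R ?dd cr cph (ray x r) + (\<epsilon> * a) *\<^sub>R ?dd cph cr (ray x r)
      + (1 *\<^sub>R ?dd cth cth (ray x r) + (?co / ?s) *\<^sub>R ?d cth (ray x r) + (a\<^sup>2 * ?s\<^sup>2) *\<^sub>R ?dd cw cw (ray x r)
        + a *\<^sub>R ?dd cw cph (ray x r) + a *\<^sub>R ?dd cph cw (ray x r) + (1 / ?s\<^sup>2) *\<^sub>R ?dd cph cph (ray x r))"
  let ?V = "wint ?\<Delta> (?dd cr cr) x + wint ?\<Delta>' (?d cr) x
      + wint ?A (?dd cr cw) x + wint ?A (?dd cw cr) x + wint ?A' (?d cw) x
      + wint (\<lambda>r. \<epsilon> * a) (?dd cr cph) x + wint (\<lambda>r. \<epsilon> * a) (?dd cph cr) x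
      + (wint (\<lambda>r. 1) (?dd cth cth) x + wint (\<lambda>r. ?co / ?s) (?d cth) x
        + wint (\<lambda>r. a\<^sup>2 * ?s\<^sup>2) (?dd cw cw) x
        + wint (\<lambda>r. a) (?dd cw cph) x + wint (\<lambda>r. a) (?dd cph cw) x + wint (\<lambda>r. 1 / ?s\<^sup>2) (?dd cph cph) x)"
  have E: "(?E has_integral ?V) {b..c}"
    by (intro has_integral_add wint_has_integral cont cp c0 x)
  have "split_wave D (kerr_h m a \<epsilon>) (kerr_O a) \<psi> (ray x r) = ?E r" if "r \<in> {b..c}" for r
  proof -
    have y: "ray x r \<in> D"
      using that x by (simp add: ray_in_D)
    have "pd i D \<psi> differentiable (at (ray x r) within D)" for i
      using smooth_upto_differentiable[OF \<psi>1] y by (simp add: differentiable_on_def)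
    then show ?thesis
      by (subst split_wave_expand[OF coord_approachable_kerr_dom y _ _ kerr_h_deriv])
         (use sin_th_pos(1) in force,
          simp_all add: sum_coord kerr_h_simps kerr_h_deriv_def)
  qed
  then have "((\<lambda>r. split_wave D (kerr_h m a \<epsilon>) (kerr_O a) \<psi> (ray x r)) has_integral ?V) {b..c}"
    using has_integral_eq[OF _ E] by simp
  also have "?V = X0\<^sup>2 *\<^sub>R (I2 - (2 * m) *\<^sub>R I1 + a\<^sup>2 *\<^sub>R I cw cw) - (2 * \<epsilon> * X0) *\<^sub>R (I2 + a\<^sup>2 *\<^sub>R I cw cw)
      + (2 * X0) *\<^sub>R (J1 - m *\<^sub>R J cw) - (2 * \<epsilon>) *\<^sub>R J1
      - (\<epsilon> * a * X0) *\<^sub>R (I cw cph + I cph cw)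
      - (2 * \<epsilon> * (b\<^sup>2 + a\<^sup>2)) *\<^sub>R ?d cw (ray x b) - (2 * \<epsilon> * a) *\<^sub>R ?d cph (ray x b)
      + (I cth cth + (?co / ?s) *\<^sub>R J cth + (a\<^sup>2 * ?s\<^sup>2) *\<^sub>R I cw cw
        + a *\<^sub>R I cw cph + a *\<^sub>R I cph cw + (1 / ?s\<^sup>2) *\<^sub>R I cph cph)"
    unfolding rr rw wr rp pr unfolding mk mkJ mA' by (simp add: scaleR_conv_of_real algebra_simps)
  finally show ?thesis .
qed

lemma whiting_identity:
  fixes \<psi> :: "point \<Rightarrow> complex"
  assumes m: "m > 0" "\<bar>a\<bar> < m" and \<epsilon>: "\<epsilon>\<^sup>2 = 1" and S: "S \<noteq> 0"
    and \<psi>: "smooth_upto D \<psi>" and x: "x \<in> W"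
    and van: "\<forall>y\<in>D. y $ cr > M \<longrightarrow> \<psi> y = 0" and M: "M < c"
  shows "whiting m a S R Rt (\<lambda>y. (cmod (kerr_q a y))\<^sup>2 *\<^sub>R wave_op D (kerr_inverse_metric m a \<epsilon>) \<psi> y) x
    = split_wave W (whiting_h m a \<epsilon> S R Rt) (kerr_O a) (whiting m a S R Rt \<psi>) x
      + horizon_term m a \<epsilon> S R Rt \<psi> x"
proof -
  note \<psi>1 = smooth_upto_pd[OF \<psi>]
  \<comment> \<open>The integral over the half-line becomes one over a compact interval, because
    \<open>F\<close> vanishes beyond \<open>M\<close> and \<open>M < c\<close>.\<close>
  have cut: "whiting m a S R Rt F y = integral {b..c} (\<lambda>r. G (ray y r))"
    if y: "y \<in> W" and F: "\<And>z. z \<in> D \<Longrightarrow> F z = G z" "\<And>z. z \<in> D \<Longrightarrow> M < z $ cr \<Longrightarrow> F z = 0"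
    for F G :: "point \<Rightarrow> complex" and y
  proof -
    have "whiting m a S R Rt F y = integral {b..} (\<lambda>r. if r \<in> {b..c} then G (ray y r) else 0)"
      unfolding whiting_def ray_def[symmetric]
    proof (rule integral_cong)
      fix r assume "r \<in> {b..}"
      then show "F (ray y r) = (if r \<in> {b..c} then G (ray y r) else 0)"
        using F ray_in_D[OF y, of r] M by auto
    qed
    also have "\<dots> = integral {b..c} (\<lambda>r. G (ray y r))"
      by (subst integral_restrict_Int) (simp add: Int_absorb2)
    finally show ?thesis .
  qed
  have diff: "pd i D \<psi> differentiable (at y within D)" if "y \<in> D" for i y
    using smooth_upto_differentiable[OF \<psi>1] that by (simp add: differentiable_on_def)
  note kerr = kerr_wave_op_eq_split_wave[OF m \<epsilon> _ diff]
  \<comment> \<open>The truncation also applies to the wave operator, whose value vanishes wherever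
    \<psi> vanishes nearby in \<open>D\<close>.\<close>
  have split0: "split_wave D (kerr_h m a \<epsilon>) (kerr_O a) \<psi> y = 0" if y: "y \<in> D" "M < y $ cr" for y
  proof -
    have U: "open {y :: point. M < y $ cr}"
      by (intro open_Collect_less continuous_intros)
    have v: "pd i D \<psi> z = 0" if "z \<in> D" "z \<in> {z. M < z $ cr}" for i z
      by (rule pd_vanish[OF coord_approachable_kerr_dom that(1) U that(2)]) (simp add: van)
    have vv: "pd i D (pd j D \<psi>) y = 0" for i j
      by (rule pd_vanish[OF coord_approachable_kerr_dom y(1) U]) (use y v in auto)
    show ?thesis
      by (subst split_wave_expand[OF coord_approachable_kerr_dom y(1) _ diff[OF y(1)] kerr_h_deriv])
         (use sin_th_pos(1) in force, use y v vv in simp)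
  qed
  have L: "whiting m a S R Rt (\<lambda>y. (cmod (kerr_q a y))\<^sup>2 *\<^sub>R wave_op D (kerr_inverse_metric m a \<epsilon>) \<psi> y) x
      = integral {b..c} (\<lambda>r. split_wave D (kerr_h m a \<epsilon>) (kerr_O a) \<psi> (ray x r))"
    by (rule cut[OF x]) (use kerr split0 in auto)
  have "split_wave W (whiting_h m a \<epsilon> S R Rt) (kerr_O a) (whiting m a S R Rt \<psi>) x
      = split_wave W (whiting_h m a \<epsilon> S R Rt) (kerr_O a) (wint (\<lambda>r. 1) \<psi>) x"
    by (rule split_wave_cong[OF x]) (use cut[of _ \<psi> \<psi>] van in \<open>simp add: wint_def\<close>)
  moreover have "horizon_term m a \<epsilon> S R Rt \<psi> x
      = - (2 * \<epsilon> * (b\<^sup>2 + a\<^sup>2)) *\<^sub>R pd cw D \<psi> (ray x b) - (2 * \<epsilon> * a) *\<^sub>R pd cph D \<psi> (ray x b)"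
    by (simp add: horizon_term_def horizon_trace_def kerr_h_simps ray_def mult.assoc)
  moreover define X0 where "X0 = X x"
  ultimately show ?thesis
    unfolding L integral_unique[OF wint_kerr_wave[OF m(2) \<psi> x van M]] split_wave_whiting[OF S \<psi> x]
      X0_def[symmetric]
    \<comment> \<open>What remains compares coefficients of moments: at second order the Taylor
      expansions at \<open>R\<close>, at first order \<open>2 * (R - m) * X0 - 2 * \<epsilon> * R +
      2 * (X0 - \<epsilon>) * (r - R) = 2 * X0 * (r - m) - 2 * \<epsilon> * r\<close>.\<close>
    by (simp only:) (simp add: scaleR_conv_of_real kerr_Delta_def algebra_simps power2_eq_square)
qed

end

text \<open>The metric is given by its inverse \<open>gt\<close> and a positive factor
  \<open>qt2\<close>, both chosen before \<psi>. Identification with a geometric wave operator is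
  claimed where \<open>gt\<close> is nondegenerate; the transform identity holds on all of
  \<open>whiting_dom\<close>.\<close>

theorem proposition3p6:
  fixes m a \<epsilon> S R Rt :: real
  assumes "m > 0" and "\<bar>a\<bar> < m" and "\<epsilon> \<in> {-1, 1}" and "S < 0"
  shows "\<exists>(gt :: point \<Rightarrow> tensor) (qt2 :: point \<Rightarrow> real).
     (\<forall>x\<in>whiting_dom.
        qt2 x > 0 \<and> transpose (gt x) = gt x \<and>
        qt2 x *\<^sub>R gt x = whiting_h m a \<epsilon> S R Rt (x $ cr) + kerr_O a x) \<and>
     (\<forall>x\<in>whiting_dom. det (gt x) \<noteq> 0 \<longrightarrow>
        (\<forall>f :: point \<Rightarrow> complex. smooth_upto whiting_dom f \<longrightarrow>
           qt2 x *\<^sub>R wave_op whiting_dom gt f x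
             = split_wave whiting_dom (whiting_h m a \<epsilon> S R Rt) (kerr_O a) f x)) \<and>
     (\<forall>\<psi> :: point \<Rightarrow> complex.
        smooth_upto (kerr_dom m a) \<psi> \<longrightarrow>
        (\<exists>M. \<forall>x\<in>kerr_dom m a. x $ cr > M \<longrightarrow> \<psi> x = 0) \<longrightarrow>
        (\<forall>x\<in>whiting_dom.
           whiting m a S R Rt
             (\<lambda>y. (cmod (kerr_q a y))\<^sup>2 *\<^sub>R wave_op (kerr_dom m a) (kerr_inverse_metric m a \<epsilon>) \<psi> y) x
           = split_wave whiting_dom (whiting_h m a \<epsilon> S R Rt) (kerr_O a) (whiting m a S R Rt \<psi>) x
             + horizon_term m a \<epsilon> S R Rt \<psi> x))"
proof (intro exI[of _ "whiting_inverse_metric m a \<epsilon> S R Rt"] exI[of _ "whiting_q2 m a \<epsilon> S Rt"]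
    conjI ballI allI impI)
  have \<epsilon>: "\<epsilon>\<^sup>2 = 1" and S: "S \<noteq> 0"
    using assms(3,4) by auto
  fix x assume x: "x \<in> whiting_dom"
  show "whiting_q2 m a \<epsilon> S Rt x > 0"
    by (rule whiting_q2_pos)
  show "transpose (whiting_inverse_metric m a \<epsilon> S R Rt x) = whiting_inverse_metric m a \<epsilon> S R Rt x"
    by (rule transpose_whiting_inverse_metric[OF x])
  show "whiting_q2 m a \<epsilon> S Rt x *\<^sub>R whiting_inverse_metric m a \<epsilon> S R Rt x
      = whiting_h m a \<epsilon> S R Rt (x $ cr) + kerr_O a x"
    by (rule whiting_inverse_metric_scaled)
  {
    fix f :: "point \<Rightarrow> complex"
    assume det: "det (whiting_inverse_metric m a \<epsilon> S R Rt x) \<noteq> 0" and f: "smooth_upto whiting_dom f"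
    have "pd i whiting_dom f differentiable (at x within whiting_dom)" for i
      using smooth_upto_differentiable[OF smooth_upto_pd[OF f]] x by (simp add: differentiable_on_def)
    then show "whiting_q2 m a \<epsilon> S Rt x *\<^sub>R wave_op whiting_dom (whiting_inverse_metric m a \<epsilon> S R Rt) f x
        = split_wave whiting_dom (whiting_h m a \<epsilon> S R Rt) (kerr_O a) f x"
      by (rule whiting_wave_op_eq_split_wave[OF \<epsilon> S x det])
  }
  {
    fix \<psi> :: "point \<Rightarrow> complex"
    assume \<psi>: "smooth_upto (kerr_dom m a) \<psi>"
      and "\<exists>M. \<forall>x\<in>kerr_dom m a. x $ cr > M \<longrightarrow> \<psi> x = 0"
    then obtain M where M: "\<forall>y\<in>kerr_dom m a. y $ cr > M \<longrightarrow> \<psi> y = 0"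
      by blast
    \<comment> \<open>The maximum keeps the interval nonempty, and \<open>M + 1\<close> puts its end
      strictly beyond the support.\<close>
    interpret whiting_transform m a S R Rt "max (r_plus m a) (M + 1)"
      by unfold_locales simp
    show "whiting m a S R Rt
          (\<lambda>y. (cmod (kerr_q a y))\<^sup>2 *\<^sub>R wave_op (kerr_dom m a) (kerr_inverse_metric m a \<epsilon>) \<psi> y) x
        = split_wave whiting_dom (whiting_h m a \<epsilon> S R Rt) (kerr_O a) (whiting m a S R Rt \<psi>) x
          + horizon_term m a \<epsilon> S R Rt \<psi> x"
      by (rule whiting_identity[OF assms(1,2) \<epsilon> S \<psi> x M]) auto
  }
qed

end
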